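(* Let $C$ be a compact metrizable space, let $\mathbb{L}_{\geq 0}$ denote the Closed Long Ray, and let $\mathbb{L}$ denote the Long Line. For every $n,m,l<\omega$, the product space $$\mathbb{L}^n \times (\mathbb{L}_{\geq 0})^m \times (\omega_1)^l \times C$$ has the Compactly Supported Homeomorphism Property (CSHP).
   Context: All spaces are assumed to be Tychonoff (completely regular Hausdorff). The Closed Long Ray is $\mathbb{L}_{\geq 0}:=\omega_1\times[0,1)$ with the order topology generated by the lexicographic order; its minimum is denoted $0$. The Long Line $\mathbb{L}$ is the quotient space obtained by gluing together two copies of $\mathbb{L}_{\geq 0}$ at their points $0$. The ordinal $\omega_1$ carries the order topology. Products carry the product topology. CSHP: For a space $X$, let $\mathscr{K}(X)$ be the poset of compact subsets of $X$ ordered by inclusion. For $K\in\mathscr{K}(X)$, let $\operatorname{Homeo}_K(X)$ be the group of homeomorphisms of $X$ that are the identity on $X\setminus K$, equipped with the compact-open topology. Put $\operatorname{Homeo}_{cpt}(X):=\bigcup_{K\in\mathscr{K}(X)}\operatorname{Homeo}_K(X)$. This group can be given two topologies: (1) the finest topology making all inclusions $\operatorname{Homeo}_K(X)\to\operatorname{Homeo}_{cpt}(X)$ continuous (the colimit in the category of topological spaces and continuous maps); and (2) the topology induced by the embedding $f\mapsto\beta f$ into $\operatorname{Homeo}(\beta X)$, where $\beta X$ is the Stone-Čech compactification of $X$ and $\operatorname{Homeo}(\beta X)$ carries the compact-open topology. The space $X$ has the Compactly Supported Homeomorphism Property (CSHP) if these two topologies coincide. *)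

theory Defs
  imports "HOL-Analysis.Analysis"
begin

section \<open>The ordinal \<open>\<omega>\<^sub>1\<close>\<close>

text \<open>
  \<open>cardSuc natLeq\<close> is a cardinal, i.e. a well-order that is minimal for its cardinality, and it is
  the successor of \<open>\<aleph>\<^sub>0\<close>; so it has order type \<open>\<omega>\<^sub>1\<close>.
  See \<open>uncountable_omega1\<close> and \<open>countable_lessThan_omega1\<close> below.
\<close>

typedef omega1 = "Field (cardSuc natLeq)"
  using Field_cardSuc_not_empty[OF natLeq_Card_order] by auto

lemma Well_order_cardSuc_natLeq: "Well_order (cardSuc natLeq)"
  using cardSuc_Card_order[OF natLeq_Card_order] by (simp add: card_order_on_def)

instantiation omega1 :: linorder
begin

definition less_eq_omega1 :: "omega1 \<Rightarrow> omega1 \<Rightarrow> bool"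
  where "x \<le> y \<longleftrightarrow> (Rep_omega1 x, Rep_omega1 y) \<in> cardSuc natLeq"

definition less_omega1 :: "omega1 \<Rightarrow> omega1 \<Rightarrow> bool"
  where "(x :: omega1) < y \<longleftrightarrow> x \<le> y \<and> \<not> y \<le> x"

instance
proof
  have L: "Refl (cardSuc natLeq)" "trans (cardSuc natLeq)" "antisym (cardSuc natLeq)"
    "Total (cardSuc natLeq)"
    using Well_order_cardSuc_natLeq
    by (auto simp: well_order_on_def linear_order_on_def partial_order_on_def preorder_on_def)
  fix x y z :: omega1
  show "x < y \<longleftrightarrow> x \<le> y \<and> \<not> y \<le> x"
    by (rule less_omega1_def)
  show r: "x \<le> x" for x :: omega1
    using L(1) Rep_omega1[of x] by (auto simp: less_eq_omega1_def refl_on_def)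
  show "x \<le> z" if "x \<le> y" "y \<le> z"
    using that L(2) unfolding less_eq_omega1_def by (meson transD)
  show "x = y" if "x \<le> y" "y \<le> x"
    using that L(3) unfolding less_eq_omega1_def by (meson antisymD Rep_omega1_inject)
  show "x \<le> y \<or> y \<le> x"
  proof (cases "x = y")
    case False
    then have "Rep_omega1 x \<noteq> Rep_omega1 y"
      by (simp add: Rep_omega1_inject)
    then show ?thesis
      using L(4) Rep_omega1[of x] Rep_omega1[of y] unfolding less_eq_omega1_def total_on_def by blast
  qed (simp add: r)
qed

end

instance omega1 :: wellorder
proof (rule wf_wellorderI)
  have "wf (cardSuc natLeq - Id)"
    using Well_order_cardSuc_natLeq by (simp add: well_order_on_def)
  then have "wf (inv_image (cardSuc natLeq - Id) Rep_omega1)"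
    by (rule wf_inv_image)
  then show "wf {(x, y :: omega1). x < y}"
    by (rule wf_subset) (auto simp: inv_image_def Rep_omega1_inject order_less_le less_eq_omega1_def)
qed standard

instantiation omega1 :: linorder_topology
begin

definition open_omega1 :: "omega1 set \<Rightarrow> bool"
  where "open_omega1 = generate_topology (range (\<lambda>a. {..< a}) \<union> range (\<lambda>a. {a <..}))"

instance
  by standard (rule open_omega1_def)

end

context
  includes cardinal_syntax
begin

lemma countable_iff_ordLeq_natLeq: "countable A \<longleftrightarrow> |A| \<le>o natLeq"
proof -
  have "countable A \<longleftrightarrow> |A| \<le>o |UNIV :: nat set|"
    using card_of_ordLeq[of A "UNIV :: nat set"] by (simp add: countable_def)
  also have "\<dots> \<longleftrightarrow> |A| \<le>o natLeq"
    using card_of_nat ordLeq_ordIso_trans ordIso_symmetric by blast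
  finally show ?thesis .
qed

lemma uncountable_omega1: "uncountable (UNIV :: omega1 set)"
proof
  assume "countable (UNIV :: omega1 set)"
  then have "countable (Field (cardSuc natLeq))"
    by (metis countable_image type_definition.Rep_range type_definition_omega1)
  then have "|Field (cardSuc natLeq)| \<le>o natLeq"
    by (simp add: countable_iff_ordLeq_natLeq)
  then have "cardSuc natLeq \<le>o natLeq"
    using card_of_Field_ordIso[OF cardSuc_Card_order[OF natLeq_Card_order]]
      ordIso_ordLeq_trans ordIso_symmetric by blast
  then show False
    using cardSuc_greater[OF natLeq_Card_order] not_ordLess_ordLeq by blast
qed

lemma countable_lessThan_omega1: "countable {..< a :: omega1}"
proof -
  have "|underS (cardSuc natLeq) (Rep_omega1 a)| <o cardSuc natLeq"
    by (rule card_of_underS[OF cardSuc_Card_order[OF natLeq_Card_order] Rep_omega1])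
  then have "countable (underS (cardSuc natLeq) (Rep_omega1 a))"
    using cardSuc_ordLeq_ordLess[OF card_of_Card_order natLeq_Card_order]
      cardSuc_ordLeq_ordLess[OF natLeq_Card_order card_of_Card_order]
    by (auto simp: countable_iff_ordLeq_natLeq)
  moreover have "Rep_omega1 ` {..<a} \<subseteq> underS (cardSuc natLeq) (Rep_omega1 a)"
    by (auto simp: underS_def Rep_omega1_inject order_less_le less_eq_omega1_def)
  ultimately have "countable (Rep_omega1 ` {..<a})"
    using countable_subset by blast
  then show ?thesis
    by (rule countable_image_inj_on) (simp add: inj_on_def Rep_omega1_inject)
qed

end


section \<open>The Closed Long Ray and the Long Line\<close>

typedef long_ray = "(UNIV :: omega1 set) \<times> {0..<1 :: real}"
  by force

instantiation long_ray :: linorder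
begin

definition less_eq_long_ray :: "long_ray \<Rightarrow> long_ray \<Rightarrow> bool"
  where "x \<le> y \<longleftrightarrow> fst (Rep_long_ray x) < fst (Rep_long_ray y)
    \<or> fst (Rep_long_ray x) = fst (Rep_long_ray y) \<and> snd (Rep_long_ray x) \<le> snd (Rep_long_ray y)"

definition less_long_ray :: "long_ray \<Rightarrow> long_ray \<Rightarrow> bool"
  where "(x :: long_ray) < y \<longleftrightarrow> x \<le> y \<and> \<not> y \<le> x"

instance
  by standard
    (auto simp: less_eq_long_ray_def less_long_ray_def Rep_long_ray_inject[symmetric] prod_eq_iff)

end

instantiation long_ray :: linorder_topology
begin

definition open_long_ray :: "long_ray set \<Rightarrow> bool"
  where "open_long_ray = generate_topology (range (\<lambda>a. {..< a}) \<union> range (\<lambda>a. {a <..}))"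

instance
  by standard (rule open_long_ray_def)

end

instantiation long_ray :: zero
begin

definition zero_long_ray :: long_ray
  where "zero_long_ray = Abs_long_ray (LEAST a. True, 0)"

instance ..

end

lemma zero_le_long_ray: "0 \<le> (x :: long_ray)"
proof -
  have "Rep_long_ray 0 = (LEAST a. True, 0)"
    by (simp add: zero_long_ray_def Abs_long_ray_inverse)
  moreover have "(LEAST a. True) \<le> fst (Rep_long_ray x)"
    by (rule Least_le) simp
  moreover have "0 \<le> snd (Rep_long_ray x)"
    using Rep_long_ray[of x] by (auto simp: mem_Times_iff)
  ultimately show ?thesis
    by (auto simp: less_eq_long_ray_def)
qed

text \<open>
  \<open>bool\<close> carries the discrete topology, so \<open>bool \<times> long_ray\<close> is the topological sum of two copies
  of the Closed Long Ray.
\<close>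

quotient_type long_line =
  "bool \<times> long_ray" / "\<lambda>p q. p = q \<or> snd p = 0 \<and> snd q = 0"
  by (rule equivpI; unfold reflp_def symp_def transp_def) blast+

instantiation long_line :: topological_space
begin

definition open_long_line :: "long_line set \<Rightarrow> bool"
  where "open_long_line U \<longleftrightarrow> open (abs_long_line -` U)"

instance
proof
  fix K :: "long_line set set"
  assume "\<forall>S\<in>K. open S"
  then have "open (\<Union>S\<in>K. abs_long_line -` S)"
    by (auto simp: open_long_line_def)
  then show "open (\<Union>K)"
    by (simp add: open_long_line_def vimage_Union)
qed (auto simp: open_long_line_def vimage_Int)

end

lemma quotient_map_abs_long_line: "quotient_map euclidean euclidean abs_long_line"
proof -
  have "surj abs_long_line"
    by (rule surjI[of _ rep_long_line]) (rule Quotient3_abs_rep[OF Quotient3_long_line])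
  moreover have "{x. abs_long_line x \<in> U} = abs_long_line -` U" for U
    by auto
  ultimately show ?thesis
    by (simp add: quotient_map_def open_long_line_def)
qed


section \<open>Function spaces and homeomorphism groups\<close>

text \<open>
  A map out of \<open>X\<close> is represented by the HOL function that is \<open>undefined\<close> outside \<open>topspace X\<close>, so
  that maps are equal iff they agree on \<open>topspace X\<close>.
\<close>

definition continuous_maps :: "'a topology \<Rightarrow> 'b topology \<Rightarrow> ('a \<Rightarrow> 'b) set"
  where "continuous_maps X Y = {f \<in> extensional (topspace X). continuous_map X Y f}"

definition compact_open_topology :: "'a topology \<Rightarrow> 'b topology \<Rightarrow> ('a \<Rightarrow> 'b) topology"
  where "compact_open_topology X Y = topology_generated_by
    {{f \<in> continuous_maps X Y. f ` K \<subseteq> U} | K U. compactin X K \<and> openin Y U}"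

lemma topspace_compact_open_topology [simp]:
  "topspace (compact_open_topology X Y) = continuous_maps X Y"
proof -
  let ?S = "\<lambda>K U. {f \<in> continuous_maps X Y. f ` K \<subseteq> U}"
  let ?B = "{?S K U | K U. compactin X K \<and> openin Y U}"
  have "?S {} {} \<in> ?B"
    by (rule CollectI, rule exI[of _ "{}"], rule exI[of _ "{}"])
      (intro conjI refl compactin_empty openin_empty)
  then have "?S {} {} \<subseteq> \<Union>?B"
    by (rule Union_upper)
  then have "continuous_maps X Y \<subseteq> \<Union>?B"
    by simp
  moreover have "\<Union>?B \<subseteq> continuous_maps X Y"
    by (rule Union_least) auto
  ultimately show ?thesis
    by (simp only: compact_open_topology_def topology_generated_by_topspace subset_antisym)
qed

definition homeos :: "'a topology \<Rightarrow> ('a \<Rightarrow> 'a) set"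
  where "homeos X = {f \<in> extensional (topspace X). homeomorphic_map X X f}"

lemma homeos_subset_continuous_maps: "homeos X \<subseteq> continuous_maps X X"
  by (auto simp: homeos_def continuous_maps_def homeomorphic_imp_continuous_map)

definition homeo_topology :: "'a topology \<Rightarrow> ('a \<Rightarrow> 'a) topology"
  where "homeo_topology X = subtopology (compact_open_topology X X) (homeos X)"

lemma topspace_homeo_topology [simp]: "topspace (homeo_topology X) = homeos X"
  using homeos_subset_continuous_maps by (auto simp: homeo_topology_def)

definition homeos_on :: "'a topology \<Rightarrow> 'a set \<Rightarrow> ('a \<Rightarrow> 'a) set"
  where "homeos_on X K = {f \<in> homeos X. \<forall>x \<in> topspace X - K. f x = x}"

definition homeo_on_topology :: "'a topology \<Rightarrow> 'a set \<Rightarrow> ('a \<Rightarrow> 'a) topology"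
  where "homeo_on_topology X K = subtopology (homeo_topology X) (homeos_on X K)"

lemma topspace_homeo_on_topology [simp]: "topspace (homeo_on_topology X K) = homeos_on X K"
  by (auto simp: homeo_on_topology_def homeos_on_def)

definition homeos_cpt :: "'a topology \<Rightarrow> ('a \<Rightarrow> 'a) set"
  where "homeos_cpt X = (\<Union>K \<in> {K. compactin X K}. homeos_on X K)"

definition homeos_cpt_colimit_topology :: "'a topology \<Rightarrow> ('a \<Rightarrow> 'a) topology"
  where "homeos_cpt_colimit_topology X = topology (\<lambda>U. U \<subseteq> homeos_cpt X \<and>
    (\<forall>K. compactin X K \<longrightarrow> openin (homeo_on_topology X K) (U \<inter> homeos_on X K)))"

lemma openin_homeos_cpt_colimit_topology:
  "openin (homeos_cpt_colimit_topology X) U \<longleftrightarrow> U \<subseteq> homeos_cpt X \<and>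
    (\<forall>K. compactin X K \<longrightarrow> openin (homeo_on_topology X K) (U \<inter> homeos_on X K))"
proof -
  have "istopology (\<lambda>U. U \<subseteq> homeos_cpt X \<and>
    (\<forall>K. compactin X K \<longrightarrow> openin (homeo_on_topology X K) (U \<inter> homeos_on X K)))"
    (is "istopology ?open")
    unfolding istopology_def
  proof (intro conjI allI impI)
    fix S T K
    assume S: "?open S" and T: "?open T"
    then show "S \<inter> T \<subseteq> homeos_cpt X"
      by auto
    assume "compactin X K"
    then have "openin (homeo_on_topology X K) ((S \<inter> homeos_on X K) \<inter> (T \<inter> homeos_on X K))"
      using S T by (simp only: openin_Int)
    moreover have "(S \<inter> homeos_on X K) \<inter> (T \<inter> homeos_on X K) = S \<inter> T \<inter> homeos_on X K"
      by auto
    ultimately show "openin (homeo_on_topology X K) (S \<inter> T \<inter> homeos_on X K)"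
      by simp
  next
    fix \<K> K
    assume \<K>: "\<forall>S\<in>\<K>. ?open S"
    then show "\<Union>\<K> \<subseteq> homeos_cpt X"
      by auto
    assume "compactin X K"
    then have "openin (homeo_on_topology X K) (\<Union>S\<in>\<K>. S \<inter> homeos_on X K)"
      using \<K> by (intro openin_Union) auto
    moreover have "(\<Union>S\<in>\<K>. S \<inter> homeos_on X K) = \<Union>\<K> \<inter> homeos_on X K"
      by auto
    ultimately show "openin (homeo_on_topology X K) (\<Union>\<K> \<inter> homeos_on X K)"
      by simp
  qed
  then show ?thesis
    by (simp add: homeos_cpt_colimit_topology_def topology_inverse')
qed

lemma topspace_homeos_cpt_colimit_topology [simp]:
  "topspace (homeos_cpt_colimit_topology X) = homeos_cpt X"
proof (rule antisym)
  show "topspace (homeos_cpt_colimit_topology X) \<subseteq> homeos_cpt X"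
    using openin_homeos_cpt_colimit_topology openin_topspace by blast
  have "homeos_cpt X \<inter> homeos_on X K = topspace (homeo_on_topology X K)" if "compactin X K" for K
    using that by (auto simp: homeos_cpt_def)
  then have "openin (homeos_cpt_colimit_topology X) (homeos_cpt X)"
    unfolding openin_homeos_cpt_colimit_topology by (metis openin_topspace order_refl)
  then show "homeos_cpt X \<subseteq> topspace (homeos_cpt_colimit_topology X)"
    by (rule openin_subset)
qed

lemma continuous_map_into_homeos_cpt_colimit:
  "compactin X K \<Longrightarrow> continuous_map (homeo_on_topology X K) (homeos_cpt_colimit_topology X) (\<lambda>f. f)"
  unfolding continuous_map_def
proof (intro conjI allI impI)
  fix U
  assume "compactin X K" "openin (homeos_cpt_colimit_topology X) U"
  then have "openin (homeo_on_topology X K) (U \<inter> homeos_on X K)"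
    by (simp add: openin_homeos_cpt_colimit_topology)
  moreover have "{f \<in> topspace (homeo_on_topology X K). f \<in> U} = U \<inter> homeos_on X K"
    by auto
  ultimately show "openin (homeo_on_topology X K) {f \<in> topspace (homeo_on_topology X K). f \<in> U}"
    by simp
qed (auto simp: homeos_cpt_def)

lemma homeos_cpt_colimit_topology_finest:
  assumes "topspace T = homeos_cpt X"
    and "\<And>K. compactin X K \<Longrightarrow> continuous_map (homeo_on_topology X K) T (\<lambda>f. f)"
    and "openin T U"
  shows "openin (homeos_cpt_colimit_topology X) U"
  unfolding openin_homeos_cpt_colimit_topology
proof (intro conjI allI impI)
  show "U \<subseteq> homeos_cpt X"
    using assms(1,3) openin_subset by blast
  fix K
  assume "compactin X K"
  from openin_continuous_map_preimage[OF assms(2)[OF this] assms(3)]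
  have "openin (homeo_on_topology X K) {f \<in> topspace (homeo_on_topology X K). f \<in> U}" .
  moreover have "{f \<in> topspace (homeo_on_topology X K). f \<in> U} = U \<inter> homeos_on X K"
    by auto
  ultimately show "openin (homeo_on_topology X K) (U \<inter> homeos_on X K)"
    by simp
qed


section \<open>The Stone-Cech compactification\<close>

abbreviation unit_interval :: "real topology"
  where "unit_interval \<equiv> top_of_set {0..1}"

definition tychonoff_cube :: "'a topology \<Rightarrow> (('a \<Rightarrow> real) \<Rightarrow> real) topology"
  where "tychonoff_cube X = product_topology (\<lambda>g. unit_interval) (continuous_maps X unit_interval)"

definition stone_cech_embedding :: "'a topology \<Rightarrow> 'a \<Rightarrow> ('a \<Rightarrow> real) \<Rightarrow> real"
  where "stone_cech_embedding X x = (\<lambda>g \<in> continuous_maps X unit_interval. g x)"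

definition stone_cech :: "'a topology \<Rightarrow> (('a \<Rightarrow> real) \<Rightarrow> real) topology"
  where "stone_cech X = subtopology (tychonoff_cube X)
    (tychonoff_cube X closure_of (stone_cech_embedding X ` topspace X))"

text \<open>\<open>\<beta>f\<close> is the unique continuous extension of \<open>f\<close>; see \<open>stone_cech_map_ex1\<close> below.\<close>

definition stone_cech_map ::
  "'a topology \<Rightarrow> ('a \<Rightarrow> 'a) \<Rightarrow> (('a \<Rightarrow> real) \<Rightarrow> real) \<Rightarrow> (('a \<Rightarrow> real) \<Rightarrow> real)"
  where "stone_cech_map X f = (THE F. F \<in> continuous_maps (stone_cech X) (stone_cech X) \<and>
    (\<forall>x \<in> topspace X. F (stone_cech_embedding X x) = stone_cech_embedding X (f x)))"

lemma compact_space_tychonoff_cube: "compact_space (tychonoff_cube X)"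
proof -
  have "compact_space unit_interval"
    by (simp add: compact_space_subtopology)
  then show ?thesis
    by (simp add: tychonoff_cube_def compact_space_product_topology)
qed

lemma compact_space_stone_cech: "compact_space (stone_cech X)"
  unfolding stone_cech_def
  by (rule compact_space_subtopology,
      rule closedin_compact_space[OF compact_space_tychonoff_cube closedin_closure_of])

lemma Hausdorff_space_stone_cech: "Hausdorff_space (stone_cech X)"
  unfolding stone_cech_def tychonoff_cube_def
  by (rule Hausdorff_space_subtopology)
    (simp add: Hausdorff_space_product_topology Hausdorff_space_subtopology)

lemma continuous_map_stone_cech_embedding_cube:
  "continuous_map X (tychonoff_cube X) (stone_cech_embedding X)"
  by (auto simp: tychonoff_cube_def stone_cech_embedding_def continuous_map_componentwise
      continuous_maps_def)

lemma stone_cech_embedding_image_subset: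
  "stone_cech_embedding X ` topspace X \<subseteq> topspace (tychonoff_cube X)"
  using continuous_map_image_subset_topspace[OF continuous_map_stone_cech_embedding_cube] .

lemma topspace_stone_cech:
  "topspace (stone_cech X) = tychonoff_cube X closure_of (stone_cech_embedding X ` topspace X)"
  by (simp add: stone_cech_def closure_of_subset_topspace Int_absorb1)

lemma stone_cech_embedding_in_topspace:
  assumes "x \<in> topspace X"
  shows "stone_cech_embedding X x \<in> topspace (stone_cech X)"
proof -
  have "stone_cech_embedding X x \<in> stone_cech_embedding X ` topspace X"
    using assms by (rule imageI)
  then show ?thesis
    unfolding topspace_stone_cech
    by (rule subsetD[OF closure_of_subset[OF stone_cech_embedding_image_subset]])
qed

lemma stone_cech_embedding_dense:
  "stone_cech X closure_of (stone_cech_embedding X ` topspace X) = topspace (stone_cech X)"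
proof -
  let ?S = "stone_cech_embedding X ` topspace X"
  let ?T = "tychonoff_cube X closure_of ?S"
  have "?S \<subseteq> ?T"
    by (rule closure_of_subset[OF stone_cech_embedding_image_subset])
  then have "subtopology (tychonoff_cube X) ?T closure_of ?S = ?T"
    by (simp add: closure_of_subtopology Int_absorb1)
  then show ?thesis
    unfolding topspace_stone_cech unfolding stone_cech_def .
qed

lemma embedding_map_stone_cech_embedding:
  assumes "completely_regular_space X" "Hausdorff_space X"
  shows "embedding_map X (stone_cech X) (stone_cech_embedding X)"
proof -
  have "bounded (f ` topspace X)" if "f \<in> topspace X \<rightarrow> {0..1::real}" for f
    by (rule bounded_subset[of "{0..1}"]) (use that in auto)
  then have "mspace (submetric (cfunspace X euclidean_metric) {f. f \<in> topspace X \<rightarrow> {0..1::real}})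
      = continuous_maps X unit_interval"
    by (auto simp: continuous_maps_def continuous_map_in_subtopology)
  then have "embedding_map X (tychonoff_cube X) (stone_cech_embedding X)"
    using completely_regular_space_cube_embedding_explicit[OF assms]
    by (simp add: tychonoff_cube_def stone_cech_embedding_def[abs_def])
  then show ?thesis
    using stone_cech_embedding_in_topspace topspace_stone_cech
    by (force simp: stone_cech_def embedding_map_in_subtopology)
qed

lemma continuous_map_into_stone_cech:
  "continuous_map T (stone_cech X) h \<longleftrightarrow>
    continuous_map T (tychonoff_cube X) h \<and> h \<in> topspace T \<rightarrow> topspace (stone_cech X)"
  unfolding topspace_stone_cech unfolding stone_cech_def by (rule continuous_map_in_subtopology)

lemma stone_cech_map_ex1:
  assumes f: "continuous_map X X f"
  shows "\<exists>!F. F \<in> continuous_maps (stone_cech X) (stone_cech X) \<and>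
    (\<forall>x \<in> topspace X. F (stone_cech_embedding X x) = stone_cech_embedding X (f x))"
proof (rule ex_ex1I)
  let ?I = "continuous_maps X unit_interval"
  define pre where "pre g = restrict (g \<circ> f) (topspace X)" for g :: "'a \<Rightarrow> real"
  define G where "G p = (\<lambda>g \<in> ?I. p (pre g))" for p :: "('a \<Rightarrow> real) \<Rightarrow> real"
  have pre: "pre g \<in> ?I" if "g \<in> ?I" for g
  proof -
    have "continuous_map X unit_interval g"
      using that by (simp only: continuous_maps_def mem_Collect_eq)
    then have "continuous_map X unit_interval (g \<circ> f)"
      by (rule continuous_map_compose[OF f])
    then have "continuous_map X unit_interval (pre g)"
      by (rule continuous_map_eq) (simp add: pre_def)
    then show ?thesis
      by (simp add: continuous_maps_def pre_def)
  qed
  have G: "continuous_map (tychonoff_cube X) (tychonoff_cube X) G"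
    unfolding tychonoff_cube_def continuous_map_componentwise
  proof (intro conjI ballI)
    fix g assume g: "g \<in> ?I"
    then have "(\<lambda>p. G p g) = (\<lambda>p. p (pre g))"
      by (simp add: G_def)
    then show "continuous_map (product_topology (\<lambda>g. unit_interval) ?I) unit_interval (\<lambda>p. G p g)"
      using continuous_map_product_projection[OF pre[OF g], of "\<lambda>_. unit_interval"] by simp
  qed (auto simp: G_def)
  have Ge: "G (stone_cech_embedding X x) = stone_cech_embedding X (f x)" if x: "x \<in> topspace X" for x
  proof
    fix g
    show "G (stone_cech_embedding X x) g = stone_cech_embedding X (f x) g"
    proof (cases "g \<in> ?I")
      case True
      then have "G (stone_cech_embedding X x) g = stone_cech_embedding X x (pre g)"
        by (simp add: G_def)
      also have "\<dots> = pre g x"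
        using pre[OF True] by (simp add: stone_cech_embedding_def)
      also have "\<dots> = g (f x)"
        using x by (simp add: pre_def)
      also have "\<dots> = stone_cech_embedding X (f x) g"
        using True by (simp add: stone_cech_embedding_def)
      finally show ?thesis .
    qed (simp add: G_def stone_cech_embedding_def)
  qed
  have fX: "f x \<in> topspace X" if "x \<in> topspace X" for x
    using f that by (auto simp: continuous_map_def)
  have "G ` stone_cech_embedding X ` topspace X \<subseteq> stone_cech_embedding X ` topspace X"
    using Ge fX by (simp add: image_subset_iff)
  then have "G ` topspace (stone_cech X) \<subseteq> topspace (stone_cech X)"
    unfolding topspace_stone_cech
    by (rule order_trans[OF continuous_map_image_closure_subset[OF G] closure_of_mono])
  moreover have "continuous_map (stone_cech X) (tychonoff_cube X) G"
    unfolding stone_cech_def by (rule continuous_map_from_subtopology[OF G])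
  ultimately have "continuous_map (stone_cech X) (stone_cech X) G"
    unfolding continuous_map_into_stone_cech by (simp add: image_subset_iff_funcset)
  then have "continuous_map (stone_cech X) (stone_cech X) (restrict G (topspace (stone_cech X)))"
    by (rule continuous_map_eq) simp
  then show "\<exists>F. F \<in> continuous_maps (stone_cech X) (stone_cech X) \<and>
      (\<forall>x \<in> topspace X. F (stone_cech_embedding X x) = stone_cech_embedding X (f x))"
    by (intro exI[of _ "restrict G (topspace (stone_cech X))"])
      (simp add: continuous_maps_def stone_cech_embedding_in_topspace Ge)
next
  fix F H
  assume F: "F \<in> continuous_maps (stone_cech X) (stone_cech X) \<and>
      (\<forall>x \<in> topspace X. F (stone_cech_embedding X x) = stone_cech_embedding X (f x))"
    and H: "H \<in> continuous_maps (stone_cech X) (stone_cech X) \<and>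
      (\<forall>x \<in> topspace X. H (stone_cech_embedding X x) = stone_cech_embedding X (f x))"
  show "F = H"
  proof (rule extensionalityI)
    show "F \<in> extensional (topspace (stone_cech X))" "H \<in> extensional (topspace (stone_cech X))"
      using F H by (simp_all add: continuous_maps_def)
    fix p assume "p \<in> topspace (stone_cech X)"
    then have "p \<in> stone_cech X closure_of (stone_cech_embedding X ` topspace X)"
      by (simp add: stone_cech_embedding_dense)
    moreover have "continuous_map (stone_cech X) (stone_cech X) F"
      "continuous_map (stone_cech X) (stone_cech X) H"
      using F H by (simp_all add: continuous_maps_def)
    moreover have "F q = H q" if "q \<in> stone_cech_embedding X ` topspace X" for q
      using F H that by force
    ultimately show "F p = H p"
      by (rule forall_in_closure_of_eq[OF _ Hausdorff_space_stone_cech])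
  qed
qed

lemma
  assumes "continuous_map X X f"
  shows stone_cech_map_in_continuous_maps:
      "stone_cech_map X f \<in> continuous_maps (stone_cech X) (stone_cech X)"
    and stone_cech_map_embedding:
      "x \<in> topspace X \<Longrightarrow>
        stone_cech_map X f (stone_cech_embedding X x) = stone_cech_embedding X (f x)"
  using theI'[OF stone_cech_map_ex1[OF assms], folded stone_cech_map_def] by blast+

lemma stone_cech_map_inverse:
  assumes f: "continuous_map X X f" and g: "continuous_map X X g"
    and gf: "\<And>x. x \<in> topspace X \<Longrightarrow> g (f x) = x"
    and p: "p \<in> topspace (stone_cech X)"
  shows "stone_cech_map X g (stone_cech_map X f p) = p"
proof -
  have "p \<in> stone_cech X closure_of (stone_cech_embedding X ` topspace X)"
    using p by (simp add: stone_cech_embedding_dense)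
  then have "(stone_cech_map X g \<circ> stone_cech_map X f) p = id p"
  proof (rule forall_in_closure_of_eq[OF _ Hausdorff_space_stone_cech])
    show "continuous_map (stone_cech X) (stone_cech X) (stone_cech_map X g \<circ> stone_cech_map X f)"
      using stone_cech_map_in_continuous_maps[OF f] stone_cech_map_in_continuous_maps[OF g]
      by (auto simp: continuous_maps_def intro: continuous_map_compose)
    fix q assume "q \<in> stone_cech_embedding X ` topspace X"
    then show "(stone_cech_map X g \<circ> stone_cech_map X f) q = id q"
      using f gf by (auto simp: stone_cech_map_embedding[OF f] stone_cech_map_embedding[OF g]
          continuous_map_def Pi_iff)
  qed simp
  then show ?thesis
    by simp
qed

lemma stone_cech_map_in_homeos:
  assumes "f \<in> homeos X"
  shows "stone_cech_map X f \<in> homeos (stone_cech X)"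
proof -
  obtain g where g: "homeomorphic_maps X X f g"
    using assms by (auto simp: homeos_def homeomorphic_map_maps)
  then have c: "continuous_map X X f" "continuous_map X X g"
    and inv: "\<And>x. x \<in> topspace X \<Longrightarrow> g (f x) = x" "\<And>x. x \<in> topspace X \<Longrightarrow> f (g x) = x"
    by (auto simp: homeomorphic_maps_def)
  have "homeomorphic_maps (stone_cech X) (stone_cech X) (stone_cech_map X f) (stone_cech_map X g)"
    using stone_cech_map_in_continuous_maps[OF c(1)] stone_cech_map_in_continuous_maps[OF c(2)]
      stone_cech_map_inverse[OF c inv(1)] stone_cech_map_inverse[OF c(2,1) inv(2)]
    by (simp add: homeomorphic_maps_def continuous_maps_def)
  then show ?thesis
    using stone_cech_map_in_continuous_maps[OF c(1)]
    by (auto simp: homeos_def homeomorphic_map_maps continuous_maps_def)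
qed

lemma inj_on_stone_cech_map:
  assumes "completely_regular_space X" "Hausdorff_space X"
  shows "inj_on (stone_cech_map X) (homeos X)"
proof (rule inj_onI)
  fix f g
  assume f: "f \<in> homeos X" and g: "g \<in> homeos X" and eq: "stone_cech_map X f = stone_cech_map X g"
  have c: "continuous_map X X f" "continuous_map X X g"
    using f g homeos_subset_continuous_maps by (auto simp: continuous_maps_def)
  have inj: "inj_on (stone_cech_embedding X) (topspace X)"
    using embedding_map_stone_cech_embedding[OF assms]
    by (auto simp: embedding_map_def homeomorphic_eq_everything_map)
  show "f = g"
  proof (rule extensionalityI)
    show "f \<in> extensional (topspace X)" "g \<in> extensional (topspace X)"
      using f g by (auto simp: homeos_def)
    fix x assume x: "x \<in> topspace X"
    then have "stone_cech_embedding X (f x) = stone_cech_embedding X (g x)"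
      using eq stone_cech_map_embedding[OF c(1)] stone_cech_map_embedding[OF c(2)] by metis
    then show "f x = g x"
      using inj x c by (auto simp: continuous_map_def Pi_iff dest: inj_onD)
  qed
qed


section \<open>The Compactly Supported Homeomorphism Property\<close>

definition homeos_cpt_stone_cech_topology :: "'a topology \<Rightarrow> ('a \<Rightarrow> 'a) topology"
  where "homeos_cpt_stone_cech_topology X =
    pullback_topology (homeos_cpt X) (stone_cech_map X) (homeo_topology (stone_cech X))"

lemma topspace_homeos_cpt_stone_cech_topology [simp]:
  "topspace (homeos_cpt_stone_cech_topology X) = homeos_cpt X"
proof -
  have "stone_cech_map X f \<in> homeos (stone_cech X)" if "f \<in> homeos_cpt X" for f
    using that by (intro stone_cech_map_in_homeos) (auto simp: homeos_cpt_def homeos_on_def)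
  then show ?thesis
    by (auto simp: homeos_cpt_stone_cech_topology_def topspace_pullback_topology)
qed

text \<open>Meant for Tychonoff \<open>X\<close>, where \<open>f \<mapsto> \<beta>f\<close> is injective (\<open>inj_on_stone_cech_map\<close>).\<close>

definition CSHP :: "'a topology \<Rightarrow> bool"
  where "CSHP X \<longleftrightarrow> homeos_cpt_colimit_topology X = homeos_cpt_stone_cech_topology X"

end

theory Submission
  imports Defs
begin

text \<open>
  For every space the topology from \<open>\<beta>X\<close> is coarser than the colimit topology, because a homeomorphism
  with support in \<open>K\<close> extends to \<open>\<beta>X\<close> by the identity off \<open>K\<close> (\<open>stone_cech_topology_coarser\<close>). The
  content lies in the converse: a neighbourhood \<open>U\<close> of \<open>f\<close> for the colimit topology has to contain
  all compactly supported \<open>h\<close> with \<open>|\<phi>(h x) - \<phi>(f x)| < \<epsilon>\<close> for all \<open>x\<close>, for some \<open>\<epsilon> > 0\<close> and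
  finitely many continuous \<open>\<phi> : X \<rightarrow> [0,1]\<close>. Such conditions may hardly restrict \<open>h\<close> near infinity:
  on \<open>\<omega>\<^sub>1\<close> and on the Closed Long Ray, every \<open>\<phi>\<close> is eventually constant.

  The spaces in question are increasing unions of compact metrizable sets \<open>K \<alpha>\<close>, \<open>\<alpha> < \<omega>\<^sub>1\<close>, with every
  compact set inside some \<open>K \<alpha>\<close>. If no neighbourhood as above is contained in \<open>U\<close>, choose counterexamples
  \<open>h 0, h 1, \<dots>\<close> one after the other, with supports in \<open>K (\<sigma> 0), K (\<sigma> 1), \<dots>\<close>, each of them close to
  \<open>f\<close> for ever more functions that separate the points of the earlier stages. Countably many indices
  have a supremum \<open>\<gamma>\<close> in \<open>\<omega>\<^sub>1\<close>, so all of this takes place in the single compact set \<open>K \<gamma>\<close>. If the functions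
  of the stages \<open>\<sigma> n\<close> separate the points of \<open>K \<gamma>\<close>, then \<open>h n\<close> converges to \<open>f\<close> in the group of
  homeomorphisms supported in \<open>K \<gamma>\<close>, and so enters \<open>U\<close> (\<open>stone_cech_neighbourhood\<close>). In this way an
  escape to infinity along the stages turns into convergence at \<open>\<gamma>\<close>: in the Closed Long Ray, for
  example, disjoint supports that move up to \<open>\<gamma>\<close> shrink to a point.

  The locale \<open>omega1_exhaustion\<close> collects what this argument needs. Its separation property holds because the
  functions of stage \<open>\<sigma>\<close> factor through a retraction \<open>x \<mapsto> min x \<sigma>\<close>, and these retractions jointly
  distinguish the points below \<open>\<gamma>\<close> (\<open>omega1_exhaustible_linorder\<close>, for \<open>\<omega>\<^sub>1\<close> and the Closed Long Ray). It
  passes to finite products and to closed subspaces, among them the Long Line as the two axes in a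
  product of two Closed Long Rays; a compact metrizable space has a constant exhaustion.
\<close>


section \<open>Comparison of the two topologies\<close>

lemma homeos_on_mono: "K \<subseteq> L \<Longrightarrow> homeos_on X K \<subseteq> homeos_on X L"
  by (auto simp: homeos_on_def)

lemma homeos_on_continuous_map: "f \<in> homeos_on X K \<Longrightarrow> continuous_map X X f"
  by (auto simp: homeos_on_def homeos_def homeomorphic_imp_continuous_map)

lemma homeos_on_subset_homeos_cpt: "compactin X K \<Longrightarrow> homeos_on X K \<subseteq> homeos_cpt X"
  by (auto simp: homeos_cpt_def)

lemma homeos_on_preserves_support:
  assumes "f \<in> homeos_on X K" "x \<in> K" "x \<in> topspace X"
  shows "f x \<in> K"
proof (rule ccontr)
  have inj: "inj_on f (topspace X)" and fx: "f x \<in> topspace X"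
    using assms by (auto simp: homeos_on_def homeos_def homeomorphic_eq_everything_map)
  assume "f x \<notin> K"
  then have "f (f x) = f x"
    using assms fx by (auto simp: homeos_on_def)
  then show False
    using inj_onD[OF inj _ fx assms(3)] \<open>f x \<notin> K\<close> assms(2) by auto
qed

lemma openin_homeo_on_subbasic:
  assumes "compactin X A" "openin X V"
  shows "openin (homeo_on_topology X K) {g \<in> homeos_on X K. g ` A \<subseteq> V}"
proof -
  have "openin (compact_open_topology X X) {g \<in> continuous_maps X X. g ` A \<subseteq> V}"
    unfolding compact_open_topology_def
    by (rule topology_generated_by_Basis) (use assms in blast)
  moreover have "{g \<in> homeos_on X K. g ` A \<subseteq> V} =
      {g \<in> continuous_maps X X. g ` A \<subseteq> V} \<inter> homeos X \<inter> homeos_on X K"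
    using homeos_subset_continuous_maps[of X] by (auto simp: homeos_on_def)
  ultimately show ?thesis
    by (auto simp: homeo_on_topology_def homeo_topology_def intro!: openin_subtopology_Int)
qed

lemma continuous_map_stone_cech_embedding:
  "continuous_map X (stone_cech X) (stone_cech_embedding X)"
  unfolding continuous_map_into_stone_cech
  using continuous_map_stone_cech_embedding_cube stone_cech_embedding_in_topspace by auto

text \<open>
  The image of \<open>K\<close> is compact, hence closed in \<open>\<beta>X\<close>. A point outside it is therefore in the closure
  of the image of \<open>X - K\<close>, where \<open>\<beta>f\<close> agrees with the identity.
\<close>

lemma stone_cech_map_off_support:
  assumes K: "compactin X K" and f: "f \<in> homeos_on X K"
    and p: "p \<in> topspace (stone_cech X)" "p \<notin> stone_cech_embedding X ` K"
  shows "stone_cech_map X f p = p"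
proof -
  let ?e = "stone_cech_embedding X"
  note c = homeos_on_continuous_map[OF f]
  have "closedin (stone_cech X) (?e ` K)"
    by (intro compactin_imp_closedin Hausdorff_space_stone_cech image_compactin[OF K continuous_map_stone_cech_embedding])
  then have cl: "stone_cech X closure_of (?e ` K) = ?e ` K"
    by (simp add: closure_of_eq)
  have KX: "?e ` topspace X = ?e ` K \<union> ?e ` (topspace X - K)"
    using compactin_subset_topspace[OF K] by blast
  have "p \<in> stone_cech X closure_of (?e ` (topspace X - K))"
    using p stone_cech_embedding_dense[of X] cl unfolding KX closure_of_Un by auto
  then have "stone_cech_map X f p = id p"
  proof (rule forall_in_closure_of_eq[OF _ Hausdorff_space_stone_cech])
    show "continuous_map (stone_cech X) (stone_cech X) (stone_cech_map X f)"
      using stone_cech_map_in_continuous_maps[OF c] by (simp add: continuous_maps_def)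
    show "continuous_map (stone_cech X) (stone_cech X) id"
      by simp
    fix q assume "q \<in> ?e ` (topspace X - K)"
    then show "stone_cech_map X f q = id q"
      using f by (auto simp: stone_cech_map_embedding[OF c] homeos_on_def)
  qed
  then show ?thesis
    by simp
qed

text \<open>
  A subbasic condition \<open>\<beta>g(A) \<subseteq> V\<close> splits along the image of \<open>K\<close>: inside, it is a subbasic condition
  on \<open>g\<close> for the compact set \<open>K \<inter> A\<close>; outside, \<open>\<beta>g\<close> is the identity and the condition is the same
  for all \<open>g\<close>.
\<close>

lemma continuous_map_stone_cech_map:
  assumes K: "compactin X K"
  shows "continuous_map (homeo_on_topology X K) (homeo_topology (stone_cech X)) (stone_cech_map X)"
  unfolding homeo_topology_def[of "stone_cech X"]
proof (rule continuous_map_into_subtopology)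
  let ?e = "stone_cech_embedding X" and ?B = "stone_cech X"
  let ?S = "{{f \<in> continuous_maps ?B ?B. f ` A \<subseteq> V} | A V. compactin ?B A \<and> openin ?B V}"
  have KX: "K \<subseteq> topspace X"
    by (rule compactin_subset_topspace[OF K])
  show "stone_cech_map X \<in> topspace (homeo_on_topology X K) \<rightarrow> homeos ?B"
    using stone_cech_map_in_homeos by (auto simp: homeos_on_def)
  show "continuous_map (homeo_on_topology X K) (compact_open_topology ?B ?B) (stone_cech_map X)"
    unfolding compact_open_topology_def
  proof (rule continuous_on_generated_topo)
    fix W assume "W \<in> ?S"
    then obtain A V where W: "W = {f \<in> continuous_maps ?B ?B. f ` A \<subseteq> V}"
      and A: "compactin ?B A" and V: "openin ?B V"
      by blast
    note e = continuous_map_stone_cech_embedding[of X]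
    let ?A = "K \<inter> {x \<in> topspace X. ?e x \<in> A}" and ?V = "{x \<in> topspace X. ?e x \<in> V}"
    have "closedin ?B A"
      by (rule compactin_imp_closedin[OF Hausdorff_space_stone_cech A])
    then have "compactin X ?A"
      by (rule compact_Int_closedin[OF K closedin_continuous_map_preimage[OF e]])
    moreover have "openin X ?V"
      by (rule openin_continuous_map_preimage[OF e V])
    ultimately have op: "openin (homeo_on_topology X K) {g \<in> homeos_on X K. g ` ?A \<subseteq> ?V}"
      by (rule openin_homeo_on_subbasic)
    have AB: "A \<subseteq> topspace ?B"
      by (rule compactin_subset_topspace[OF A])
    have iff: "stone_cech_map X g \<in> W \<longleftrightarrow> A - ?e ` K \<subseteq> V \<and> g ` ?A \<subseteq> ?V"
      if g: "g \<in> homeos_on X K" for g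
    proof -
      note c = homeos_on_continuous_map[OF g]
      have "stone_cech_map X g ` A =
          stone_cech_map X g ` (A - ?e ` K) \<union> stone_cech_map X g ` ?e ` ?A"
        using KX by blast
      also have "stone_cech_map X g ` (A - ?e ` K) = A - ?e ` K"
        using stone_cech_map_off_support[OF K g] AB by force
      also have "stone_cech_map X g ` ?e ` ?A = ?e ` g ` ?A"
        using stone_cech_map_embedding[OF c] by force
      finally have "stone_cech_map X g ` A \<subseteq> V \<longleftrightarrow> A - ?e ` K \<subseteq> V \<and> ?e ` g ` ?A \<subseteq> V"
        by simp
      moreover have "g ` ?A \<subseteq> topspace X"
        using continuous_map_image_subset_topspace[OF c] by blast
      ultimately show ?thesis
        using stone_cech_map_in_continuous_maps[OF c] unfolding W by blast
    qed
    show "openin (homeo_on_topology X K)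
        (stone_cech_map X -` W \<inter> topspace (homeo_on_topology X K))"
    proof (cases "A - ?e ` K \<subseteq> V")
      case True
      then have "stone_cech_map X -` W \<inter> homeos_on X K = {g \<in> homeos_on X K. g ` ?A \<subseteq> ?V}"
        using iff by auto
      then show ?thesis
        using op by simp
    next
      case False
      then have "stone_cech_map X -` W \<inter> homeos_on X K = {}"
        using iff by auto
      then show ?thesis
        by simp
    qed
  next
    have S: "\<Union>?S = continuous_maps ?B ?B"
      using topspace_compact_open_topology[of ?B ?B]
      unfolding compact_open_topology_def topology_generated_by_topspace .
    show "stone_cech_map X ` topspace (homeo_on_topology X K) \<subseteq> \<Union>?S"
      unfolding S
    proof (rule image_subsetI)
      fix g assume "g \<in> topspace (homeo_on_topology X K)"
      then have "g \<in> homeos_on X K"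
        by simp
      then show "stone_cech_map X g \<in> continuous_maps ?B ?B"
        by (rule stone_cech_map_in_continuous_maps[OF homeos_on_continuous_map])
    qed
  qed
qed

lemma stone_cech_topology_coarser:
  assumes "openin (homeos_cpt_stone_cech_topology X) U"
  shows "openin (homeos_cpt_colimit_topology X) U"
  using assms
proof (rule homeos_cpt_colimit_topology_finest[rotated 2])
  fix K assume K: "compactin X K"
  show "continuous_map (homeo_on_topology X K) (homeos_cpt_stone_cech_topology X) (\<lambda>f. f)"
    unfolding homeos_cpt_stone_cech_topology_def
  proof (rule continuous_map_pullback')
    show "continuous_map (homeo_on_topology X K) (homeo_topology (stone_cech X))
        (stone_cech_map X \<circ> (\<lambda>f. f))"
      using continuous_map_stone_cech_map[OF K] by (simp add: o_def)
    show "topspace (homeo_on_topology X K) \<subseteq> (\<lambda>f. f) -` homeos_cpt X"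
      using homeos_on_subset_homeos_cpt[OF K] by simp
  qed
qed simp


section \<open>Uniform convergence\<close>

text \<open>
  \<open>\<phi>\<close> extends to \<open>\<beta>X\<close> as a coordinate of the cube, and on a compact space the compact-open topology
  controls uniform distance: cut \<open>[0,1]\<close> into \<open>N\<close> intervals, and require that the compact set of points
  that \<open>\<phi> \<circ> \<beta>f\<close> takes to the \<open>k\<close>-th interval is taken by \<open>\<phi> \<circ> \<beta>h\<close> to a slightly larger open one.
\<close>

lemma stone_cech_uniform_neighbourhood:
  assumes f: "f \<in> homeos_cpt X" and \<phi>: "continuous_map X unit_interval \<phi>" and "\<epsilon> > 0"
  obtains W where "openin (homeos_cpt_stone_cech_topology X) W" "f \<in> W"
    "\<And>h x. h \<in> W \<Longrightarrow> x \<in> topspace X \<Longrightarrow> \<bar>\<phi> (h x) - \<phi> (f x)\<bar> < \<epsilon>"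
proof -
  let ?e = "stone_cech_embedding X" and ?B = "stone_cech X"
  define \<psi> where "\<psi> = restrict \<phi> (topspace X)"
  have \<psi>: "\<psi> \<in> continuous_maps X unit_interval"
    using \<phi> unfolding \<psi>_def continuous_maps_def by (auto intro: continuous_map_eq)
  have e\<psi>: "?e x \<psi> = \<phi> x" if "x \<in> topspace X" for x
    using that \<psi> by (simp add: stone_cech_embedding_def \<psi>_def)
  obtain N :: nat where N: "2 / \<epsilon> < real N"
    using reals_Archimedean2 by blast
  then have N0: "N > 0"
    using \<open>\<epsilon> > 0\<close> by (intro Nat.gr0I) auto
  with N have N2: "2 / real N < \<epsilon>"
    using \<open>\<epsilon> > 0\<close> by (simp add: field_simps)
  have cpt: "g \<in> homeos X" "continuous_map X X g" "stone_cech_map X g \<in> homeos ?B"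
    if "g \<in> homeos_cpt X" for g
  proof -
    show g: "g \<in> homeos X"
      using that by (auto simp: homeos_cpt_def homeos_on_def)
    then show "continuous_map X X g"
      using homeos_subset_continuous_maps by (auto simp: continuous_maps_def)
    show "stone_cech_map X g \<in> homeos ?B"
      by (rule stone_cech_map_in_homeos[OF g])
  qed
  have proj: "continuous_map ?B euclideanreal (\<lambda>p. p \<psi>)"
    using continuous_map_product_projection[OF \<psi>, of "\<lambda>_. unit_interval"]
    unfolding stone_cech_def tychonoff_cube_def
    by (intro continuous_map_from_subtopology) (simp add: continuous_map_in_subtopology)
  have Bf: "continuous_map ?B euclideanreal (\<lambda>p. stone_cech_map X f p \<psi>)"
    using continuous_map_compose[OF _ proj, of ?B "stone_cech_map X f"]
      stone_cech_map_in_continuous_maps[OF cpt(2)[OF f]]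
    by (simp add: o_def continuous_maps_def)
  define A where "A k = {p \<in> topspace ?B. stone_cech_map X f p \<psi> \<in> {real k / N .. (real k + 1) / N}}" for k
  define V where "V k = {p \<in> topspace ?B. p \<psi> \<in> {(real k - 1) / N <..< (real k + 2) / N}}" for k
  define G where "G k = {g \<in> continuous_maps ?B ?B. g ` A k \<subseteq> V k}" for k
  have "closedin ?B (A k)" for k
    unfolding A_def by (rule closedin_continuous_map_preimage[OF Bf]) simp
  then have "compactin ?B (A k)" for k
    by (rule closedin_compact_space[OF compact_space_stone_cech])
  moreover have "openin ?B (V k)" for k
    unfolding V_def by (rule openin_continuous_map_preimage[OF proj]) simp
  ultimately have "openin (compact_open_topology ?B ?B) (G k)" for k
    unfolding compact_open_topology_def
    by (intro topology_generated_by_Basis) (unfold G_def, blast)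
  then have "openin (compact_open_topology ?B ?B) (\<Inter>k\<in>{..N}. G k)"
    by (intro openin_INT2) auto
  then have op: "openin (homeo_topology ?B) (\<Inter>k\<in>{..N}. G k \<inter> homeos ?B)"
    unfolding homeo_topology_def openin_subtopology by (intro exI conjI) (assumption, auto)
  show thesis
  proof (rule that)
    show "openin (homeos_cpt_stone_cech_topology X)
        (stone_cech_map X -` (\<Inter>k\<in>{..N}. G k \<inter> homeos ?B) \<inter> homeos_cpt X)"
      unfolding homeos_cpt_stone_cech_topology_def openin_pullback_topology using op by blast
    have "stone_cech_map X f ` A k \<subseteq> V k" for k
    proof -
      have "real k / N - 1 / N < real k / N" "(real k + 1) / N < (real k + 1) / N + 1 / N"
        using N0 by auto
      then have "{real k / N .. (real k + 1) / N} \<subseteq> {(real k - 1) / N <..< (real k + 2) / N}"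
        by (auto simp: diff_divide_distrib add_divide_distrib)
      moreover have "stone_cech_map X f ` topspace ?B \<subseteq> topspace ?B"
        using stone_cech_map_in_continuous_maps[OF cpt(2)[OF f]]
        unfolding continuous_maps_def by (simp add: continuous_map_image_subset_topspace)
      ultimately show ?thesis
        unfolding A_def V_def by blast
    qed
    then show "f \<in> stone_cech_map X -` (\<Inter>k\<in>{..N}. G k \<inter> homeos ?B) \<inter> homeos_cpt X"
      using f cpt[OF f] stone_cech_map_in_continuous_maps[OF cpt(2)[OF f]] by (auto simp: G_def)
    fix h x
    assume h: "h \<in> stone_cech_map X -` (\<Inter>k\<in>{..N}. G k \<inter> homeos ?B) \<inter> homeos_cpt X"
      and x: "x \<in> topspace X"
    have fx: "f x \<in> topspace X" and hx: "h x \<in> topspace X"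
      using x f h cpt(2) by (auto simp: continuous_map_def)
    then have t: "\<phi> (f x) \<in> {0..1}"
      using \<phi> by (auto simp: continuous_map_in_subtopology)
    \<comment> \<open>\<open>k\<close> may be \<open>N\<close>, namely when \<open>\<phi> (f x) = 1\<close>; hence the index set \<open>{..N}\<close>.\<close>
    define k where "k = nat \<lfloor>\<phi> (f x) * N\<rfloor>"
    have "\<phi> (f x) * N \<ge> 0" "\<phi> (f x) * N \<le> N"
      using t by (auto simp: mult_left_le_one_le)
    then have k: "real k \<le> \<phi> (f x) * N" "\<phi> (f x) * N \<le> real k + 1" "k \<le> N"
      unfolding k_def by linarith+
    then have k': "real k / N \<le> \<phi> (f x)" "\<phi> (f x) \<le> (real k + 1) / N"
      using N0 by (auto simp: field_simps)
    have "?e x \<in> A k"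
      using k' x fx stone_cech_embedding_in_topspace[OF x]
      by (simp add: A_def stone_cech_map_embedding[OF cpt(2)[OF f] x] e\<psi>)
    moreover have "stone_cech_map X h ` A k \<subseteq> V k" "h \<in> homeos_cpt X"
      using h k(3) by (auto simp: G_def)
    ultimately have "stone_cech_map X h (?e x) \<in> V k"
      by blast
    then have "\<phi> (h x) \<in> {(real k - 1) / N <..< (real k + 2) / N}"
      using \<open>h \<in> homeos_cpt X\<close> x hx by (simp add: V_def stone_cech_map_embedding[OF cpt(2)] e\<psi>)
    with k' have "\<bar>\<phi> (h x) - \<phi> (f x)\<bar> < 2 / N"
      by (auto simp: diff_divide_distrib add_divide_distrib abs_less_iff)
    with N2 show "\<bar>\<phi> (h x) - \<phi> (f x)\<bar> < \<epsilon>"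
      by linarith
  qed
qed

text \<open>
  Functions that separate the points of a compact set generate its topology and its uniformity. So
  for homeomorphisms supported in \<open>M\<close>, uniform convergence measured by each single \<open>\<psi> \<in> \<Psi>\<close> already
  gives convergence in the compact-open topology.
\<close>

lemma limitin_homeo_on_topology:
  assumes X: "Hausdorff_space X" and M: "compactin X M"
    and f: "f \<in> homeos_on X M" and h: "\<And>n. h n \<in> homeos_on X M"
    and \<Psi>: "\<And>\<psi>. \<psi> \<in> \<Psi> \<Longrightarrow> continuous_map X euclideanreal \<psi>"
    and sep: "\<And>x y. x \<in> M \<Longrightarrow> y \<in> M \<Longrightarrow> x \<noteq> y \<Longrightarrow> \<exists>\<psi>\<in>\<Psi>. \<psi> x \<noteq> \<psi> y"
    and conv: "\<And>\<psi> \<epsilon>. \<psi> \<in> \<Psi> \<Longrightarrow> \<epsilon> > 0 \<Longrightarrow> \<forall>\<^sub>F n in F. \<forall>x\<in>M. \<bar>\<psi> (h n x) - \<psi> (f x)\<bar> < \<epsilon>"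
  shows "limitin (homeo_on_topology X M) h f F"
proof -
  have MX: "M \<subseteq> topspace X"
    by (rule compactin_subset_topspace[OF M])
  have fM: "f x \<in> M" and hM: "h n x \<in> M" if "x \<in> M" for x n
    using that MX homeos_on_preserves_support[OF f] homeos_on_preserves_support[OF h] by auto
  have sub: "\<forall>\<^sub>F n in F. h n ` A \<subseteq> V" if A: "compactin X A" and V: "openin X V" and fA: "f ` A \<subseteq> V" for A V
  proof -
    \<comment> \<open>If \<open>h n x\<close> misses \<open>V\<close> for an \<open>x \<in> A \<inter> M\<close>, then \<open>(f x, h n x)\<close> lies in the compact set \<open>P \<times> Q\<close>, all of whose pairs
      are kept apart by finitely many of the functions, by amounts bounded away from zero.\<close>
    define P where "P = f ` (A \<inter> M)"
    define Q where "Q = M - V"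
    define W where "W = (\<lambda>(\<psi>, n). {z \<in> topspace (prod_topology X X).
      (\<bar>\<psi> (fst z) - \<psi> (snd z)\<bar> :: real) \<in> {1 / real (Suc n) <..}})"
    have "compactin X P"
      unfolding P_def by (intro image_compactin[OF _ homeos_on_continuous_map[OF f]] compactin_Int[OF X A M])
    moreover have "Q = M \<inter> (topspace X - V)"
      using MX by (auto simp: Q_def)
    then have "compactin X Q"
      using compact_Int_closedin[OF M] V by (metis closedin_diff closedin_topspace)
    ultimately have PQ: "compactin (prod_topology X X) (P \<times> Q)"
      by (simp add: compactin_Times)
    have W: "openin (prod_topology X X) (W (\<psi>, n))" if "\<psi> \<in> \<Psi>" for \<psi> n
      unfolding W_def prod.case
    proof (rule openin_continuous_map_preimage)
      have "continuous_map (prod_topology X X) euclideanreal (\<lambda>z. \<psi> (fst z))"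
        "continuous_map (prod_topology X X) euclideanreal (\<lambda>z. \<psi> (snd z))"
        using continuous_map_compose[OF continuous_map_fst \<Psi>[OF that]]
          continuous_map_compose[OF continuous_map_snd \<Psi>[OF that]] by (simp_all add: o_def)
      then show "continuous_map (prod_topology X X) euclideanreal (\<lambda>z. \<bar>\<psi> (fst z) - \<psi> (snd z)\<bar>)"
        by (intro continuous_map_real_abs continuous_map_diff)
    qed simp
    have cover: "P \<times> Q \<subseteq> \<Union> (W ` (\<Psi> \<times> UNIV))"
    proof
      fix z assume z: "z \<in> P \<times> Q"
      then obtain p q where zpq: "z = (p, q)" "p \<in> P" "q \<in> Q" by blast
      have "p \<in> M" "q \<in> M" "p \<noteq> q"
        using zpq fM fA by (auto simp: P_def Q_def)
      then obtain \<psi> where \<psi>: "\<psi> \<in> \<Psi>" "\<psi> p \<noteq> \<psi> q"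
        using sep by blast
      then obtain n where "1 / real (Suc n) < \<bar>\<psi> p - \<psi> q\<bar>"
        using nat_approx_posE[of "\<bar>\<psi> p - \<psi> q\<bar>"] by auto
      then have "z \<in> W (\<psi>, n)"
        using \<open>p \<in> M\<close> \<open>q \<in> M\<close> MX by (auto simp: W_def zpq)
      then show "z \<in> \<Union> (W ` (\<Psi> \<times> UNIV))"
        using \<psi> by blast
    qed
    obtain J where J: "finite J" "J \<subseteq> \<Psi> \<times> UNIV" "P \<times> Q \<subseteq> \<Union> (W ` J)"
    proof -
      have "\<exists>\<F>. finite \<F> \<and> \<F> \<subseteq> W ` (\<Psi> \<times> UNIV) \<and> P \<times> Q \<subseteq> \<Union>\<F>"
        using compactinD[OF PQ _ cover] W by fast
      then show thesis
        using that finite_subset_image by metis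
    qed
    have "\<forall>\<^sub>F n in F. \<forall>(\<psi>, m)\<in>J. \<forall>x\<in>M. \<bar>\<psi> (h n x) - \<psi> (f x)\<bar> < 1 / real (Suc m)"
      using J(1)
    proof (rule eventually_ball_finite)
      show "\<forall>j\<in>J. \<forall>\<^sub>F n in F. case j of (\<psi>, m) \<Rightarrow> \<forall>x\<in>M. \<bar>\<psi> (h n x) - \<psi> (f x)\<bar> < 1 / real (Suc m)"
        using J(2) by (auto intro!: conv)
    qed
    then show ?thesis
    proof (rule eventually_mono)
      fix n assume n: "\<forall>(\<psi>, m)\<in>J. \<forall>x\<in>M. \<bar>\<psi> (h n x) - \<psi> (f x)\<bar> < 1 / real (Suc m)"
      show "h n ` A \<subseteq> V"
      proof (rule image_subsetI)
        fix x assume x: "x \<in> A"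
        show "h n x \<in> V"
        proof (cases "x \<in> M")
          case True
          show ?thesis
          proof (rule ccontr)
            assume "h n x \<notin> V"
            then have "(f x, h n x) \<in> P \<times> Q"
              using True x hM by (auto simp: P_def Q_def)
            then obtain \<psi> m where "(\<psi>, m) \<in> J" "(f x, h n x) \<in> W (\<psi>, m)"
              using J(3) by fast
            then show False
              using n True by (fastforce simp: W_def abs_minus_commute)
          qed
        next
          case False
          then have "h n x = x" "f x = x"
            using x compactin_subset_topspace[OF A] f h[of n] by (auto simp: homeos_on_def)
          then show ?thesis
            using fA x by force
        qed
      qed
    qed
  qed
  have gen: "f \<in> W \<longrightarrow> (\<forall>\<^sub>F n in F. h n \<in> W)"
    if "generate_topology_on {{g \<in> continuous_maps X X. g ` A \<subseteq> V} | A V. compactin X A \<and> openin X V} W"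
    for W
    using that
  proof induction
    case (UN K)
    show ?case
    proof
      assume "f \<in> \<Union>K"
      then obtain k where "k \<in> K" "f \<in> k" by blast
      then show "\<forall>\<^sub>F n in F. h n \<in> \<Union>K"
        using UN.IH[of k] by (auto elim!: eventually_mono)
    qed
  next
    case (Basis s)
    then obtain A V where s: "s = {g \<in> continuous_maps X X. g ` A \<subseteq> V}" "compactin X A" "openin X V"
      by blast
    have "h n \<in> continuous_maps X X" for n
      using h[of n] homeos_subset_continuous_maps by (auto simp: homeos_on_def)
    then show ?case
      using sub[OF s(2,3)] s(1) by simp
  qed (auto elim: eventually_elim2)
  show ?thesis
    unfolding limitin_def
  proof (intro conjI allI impI)
    show "f \<in> topspace (homeo_on_topology X M)"
      using f by simp
    fix U assume U: "openin (homeo_on_topology X M) U \<and> f \<in> U"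
    then obtain W where W: "openin (compact_open_topology X X) W" "U = W \<inter> homeos X \<inter> homeos_on X M"
      unfolding homeo_on_topology_def homeo_topology_def openin_subtopology by auto
    then have "\<forall>\<^sub>F n in F. h n \<in> W"
      using gen U unfolding compact_open_topology_def openin_topology_generated_by_iff by blast
    then show "\<forall>\<^sub>F n in F. h n \<in> U"
      using h by (auto simp: W(2) homeos_on_def)
  qed
qed


section \<open>Exhaustions along \<open>\<omega>\<^sub>1\<close>\<close>

text \<open>
  The set has to be nonempty: the empty set has the supremum \<open>0\<close>, but a union over no indices cannot
  separate the points of a stage that belongs to \<open>0\<close>. A set may have its supremum as a member, so
  successors are suprema too.
\<close>

definition omega1_lub :: "omega1 set \<Rightarrow> omega1 \<Rightarrow> bool"
  where "omega1_lub S \<gamma> \<longleftrightarrow> S \<noteq> {} \<and> (\<forall>\<sigma>\<in>S. \<sigma> \<le> \<gamma>) \<and> (\<forall>\<delta><\<gamma>. \<exists>\<sigma>\<in>S. \<delta> < \<sigma>)"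

lemma countable_atMost_omega1: "countable {..\<alpha> :: omega1}"
proof -
  have "{..\<alpha>} = insert \<alpha> {..<\<alpha>}"
    by auto
  then show ?thesis
    using countable_lessThan_omega1 by simp
qed

lemma omega1_lub_exists:
  assumes "countable S" "S \<noteq> {}"
  obtains \<gamma> where "omega1_lub S \<gamma>"
proof -
  define \<gamma> where "\<gamma> = (LEAST \<gamma>. \<forall>\<sigma>\<in>S. \<sigma> \<le> \<gamma>)"
  have "countable (\<Union>\<sigma>\<in>S. {..\<sigma>})"
    using assms countable_atMost_omega1 by blast
  then obtain \<beta> where "\<beta> \<notin> (\<Union>\<sigma>\<in>S. {..\<sigma>})"
    using uncountable_omega1 by (metis UNIV_eq_I)
  then have "\<forall>\<sigma>\<in>S. \<sigma> \<le> \<beta>"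
    by auto
  then have "\<forall>\<sigma>\<in>S. \<sigma> \<le> \<gamma>"
    unfolding \<gamma>_def by (rule LeastI)
  moreover have "\<exists>\<sigma>\<in>S. \<delta> < \<sigma>" if "\<delta> < \<gamma>" for \<delta>
    using not_less_Least[OF that[unfolded \<gamma>_def]] by (auto simp: not_le)
  ultimately show thesis
    using that assms by (auto simp: omega1_lub_def)
qed

text \<open>
  The essential axiom is the last one. It asks for more than separation of the points of every single
  stage: at a supremum \<open>\<gamma>\<close>, which in general is a limit ordinal, the functions that belong to indices
  cofinal in \<open>\<gamma>\<close> suffice. A sequence constructed along these indices can refer to its own functions
  only, but has to converge in \<open>K \<gamma>\<close>.
\<close>

locale omega1_exhaustion =
  fixes X :: "'a topology" and K :: "omega1 \<Rightarrow> 'a set" and \<Phi> :: "omega1 \<Rightarrow> ('a \<Rightarrow> real) set"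
  assumes compact_stage: "compactin X (K \<alpha>)"
    and mono_stage: "\<alpha> \<le> \<beta> \<Longrightarrow> K \<alpha> \<subseteq> K \<beta>"
    and cofinal: "compactin X A \<Longrightarrow> \<exists>\<alpha>. A \<subseteq> K \<alpha>"
    and countable_functions: "countable (\<Phi> \<alpha>)"
    and continuous_function: "\<phi> \<in> \<Phi> \<alpha> \<Longrightarrow> continuous_map X unit_interval \<phi>"
    and separating: "omega1_lub S \<gamma> \<Longrightarrow> x \<in> K \<gamma> \<Longrightarrow> y \<in> K \<gamma> \<Longrightarrow> x \<noteq> y \<Longrightarrow>
      \<exists>\<sigma>\<in>S. \<exists>\<phi>\<in>\<Phi> \<sigma>. \<phi> x \<noteq> \<phi> y"

definition omega1_exhaustible :: "'a topology \<Rightarrow> bool"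
  where "omega1_exhaustible X \<longleftrightarrow> (\<exists>K \<Phi>. omega1_exhaustion X K \<Phi>)"

context omega1_exhaustion
begin

lemma continuous_real: "\<phi> \<in> \<Phi> \<alpha> \<Longrightarrow> continuous_map X euclideanreal \<phi>"
  using continuous_function by (auto simp: continuous_map_in_subtopology)

lemma Hausdorff: "Hausdorff_space X"
  unfolding Hausdorff_space_def
proof (intro allI impI)
  fix x y assume xy: "x \<in> topspace X \<and> y \<in> topspace X \<and> x \<noteq> y"
  then obtain \<alpha> where \<alpha>: "{x, y} \<subseteq> K \<alpha>"
    using cofinal[of "{x, y}"] finite_imp_compactin[of "{x, y}" X] by auto
  have "omega1_lub {\<alpha>} \<alpha>"
    by (simp add: omega1_lub_def)
  then obtain \<phi> where \<phi>: "\<phi> \<in> \<Phi> \<alpha>" "\<phi> x \<noteq> \<phi> y"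
    using separating[of "{\<alpha>}" \<alpha> x y] \<alpha> xy by auto
  obtain U V where UV: "open U" "open V" "\<phi> x \<in> U" "\<phi> y \<in> V" "U \<inter> V = {}"
    using separation_t2 \<phi>(2) by metis
  have "openin X {z \<in> topspace X. \<phi> z \<in> W}" if "open W" for W
    using openin_continuous_map_preimage[OF continuous_real[OF \<phi>(1)], of W] that by simp
  then show "\<exists>U V. openin X U \<and> openin X V \<and> x \<in> U \<and> y \<in> V \<and> disjnt U V"
    using UV xy by (intro exI[of _ "{z \<in> topspace X. \<phi> z \<in> U}"] exI[of _ "{z \<in> topspace X. \<phi> z \<in> V}"])
      (auto simp: disjnt_def)
qed

text \<open>Adding the zero function makes the enumeration total also when \<open>\<Phi> \<alpha>\<close> is empty.\<close>

definition stage_function :: "omega1 \<Rightarrow> nat \<Rightarrow> 'a \<Rightarrow> real"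
  where "stage_function \<alpha> = from_nat_into (insert (\<lambda>x. 0) (\<Phi> \<alpha>))"

lemma continuous_stage_function: "continuous_map X unit_interval (stage_function \<alpha> j)"
proof -
  have "stage_function \<alpha> j \<in> insert (\<lambda>x. 0) (\<Phi> \<alpha>)"
    unfolding stage_function_def by (rule from_nat_into) simp
  then show ?thesis
    using continuous_function by auto
qed

lemma stage_function_surj: "\<phi> \<in> \<Phi> \<alpha> \<Longrightarrow> \<exists>j. stage_function \<alpha> j = \<phi>"
  unfolding stage_function_def using from_nat_into_surj[of "insert (\<lambda>x. 0) (\<Phi> \<alpha>)" \<phi>] countable_functions[of \<alpha>] by auto

lemma homeos_cpt_stage: "h \<in> homeos_cpt X \<Longrightarrow> \<exists>\<alpha>. h \<in> homeos_on X (K \<alpha>)"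
  using cofinal homeos_on_mono by (fastforce simp: homeos_cpt_def)

text \<open>
  Otherwise every uniform neighbourhood of \<open>f\<close> that is given by finitely many functions contains a
  homeomorphism outside \<open>U\<close>. Choose such \<open>h n\<close> recursively, with support in \<open>K (\<sigma> n)\<close>, where \<open>h n\<close>
  is \<open>1/(n+1)\<close>-close to \<open>f\<close> for the first \<open>n\<close> functions of the stages \<open>\<sigma> 0, \<dots>, \<sigma> (n-1)\<close>. With
  \<open>\<gamma> = sup \<sigma>\<close>, all supports lie in the single compact set \<open>K \<gamma>\<close>, and the functions in question
  separate its points. So \<open>h n\<close> tends to \<open>f\<close> in the homeomorphisms supported in \<open>K \<gamma>\<close>, in which
  \<open>U\<close> is open: \<open>h n\<close> ends up in \<open>U\<close>.
\<close>

lemma stone_cech_neighbourhood: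
  assumes U: "openin (homeos_cpt_colimit_topology X) U" and f: "f \<in> U"
  shows "\<exists>W. openin (homeos_cpt_stone_cech_topology X) W \<and> f \<in> W \<and> W \<subseteq> U"
proof (rule ccontr)
  assume no: "\<nexists>W. openin (homeos_cpt_stone_cech_topology X) W \<and> f \<in> W \<and> W \<subseteq> U"
  have fc: "f \<in> homeos_cpt X"
    using U f by (auto simp: openin_homeos_cpt_colimit_topology)
  then obtain \<alpha>\<^sub>0 where \<alpha>\<^sub>0: "f \<in> homeos_on X (K \<alpha>\<^sub>0)"
    using homeos_cpt_stage by blast
  \<comment> \<open>\<open>r\<close> is a possible pair \<open>(\<sigma> n, h n)\<close> after the pairs \<open>F k\<close>, \<open>k < n\<close>. The bound \<open>\<alpha>\<^sub>0\<close> brings the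
    support of \<open>f\<close> into \<open>K \<gamma>\<close>.\<close>
  define escape where "escape F n r \<longleftrightarrow> \<alpha>\<^sub>0 \<le> fst r \<and> snd r \<in> homeos_on X (K (fst r)) - U \<and>
      (\<forall>k<n. \<forall>j<n. \<forall>x\<in>topspace X.
        \<bar>stage_function (fst (F k)) j (snd r x) - stage_function (fst (F k)) j (f x)\<bar> < 1 / real (Suc n))"
    for F :: "nat \<Rightarrow> omega1 \<times> ('a \<Rightarrow> 'a)" and n and r :: "omega1 \<times> ('a \<Rightarrow> 'a)"
  have "\<exists>F. \<forall>n. escape F n (F n)"
  proof (rule dependent_wellorder_choice)
    fix r and F G :: "nat \<Rightarrow> omega1 \<times> ('a \<Rightarrow> 'a)" and n
    assume "\<And>k. k < n \<Longrightarrow> F k = G k"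
    then show "escape F n r = escape G n r"
      by (simp add: escape_def)
  next
    fix n and F :: "nat \<Rightarrow> omega1 \<times> ('a \<Rightarrow> 'a)"
    define near where "near W k j \<longleftrightarrow> openin (homeos_cpt_stone_cech_topology X) W \<and> f \<in> W \<and>
      (\<forall>h\<in>W. \<forall>x\<in>topspace X. \<bar>stage_function (fst (F k)) j (h x) - stage_function (fst (F k)) j (f x)\<bar> < 1 / real (Suc n))"
      for W k j
    have "\<exists>W. near W k j" for k j
      unfolding near_def using stone_cech_uniform_neighbourhood[OF fc continuous_stage_function, of "1 / real (Suc n)"]
      by (metis of_nat_0_less_iff zero_less_Suc zero_less_divide_1_iff)
    then obtain W where W: "\<And>k j. near (W k j) k j"
      by metis
    define W' where "W' = \<Inter> (insert (homeos_cpt X) ((\<lambda>(k, j). W k j) ` ({..<n} \<times> {..<n})))"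
    have "openin (homeos_cpt_stone_cech_topology X) (homeos_cpt X)"
      using openin_topspace[of "homeos_cpt_stone_cech_topology X"] by simp
    then have "openin (homeos_cpt_stone_cech_topology X) W'"
      unfolding W'_def using W by (intro openin_Inter) (auto simp: near_def)
    moreover have "f \<in> W'"
      unfolding W'_def using W fc by (auto simp: near_def)
    ultimately obtain h where h: "h \<in> W'" "h \<notin> U"
      using no by blast
    then obtain \<beta> where "h \<in> homeos_on X (K \<beta>)"
      using homeos_cpt_stage[of h] by (auto simp: W'_def)
    then have "h \<in> homeos_on X (K (max \<alpha>\<^sub>0 \<beta>))"
      using homeos_on_mono[OF mono_stage[of \<beta> "max \<alpha>\<^sub>0 \<beta>"]] by auto
    moreover have "\<forall>k<n. \<forall>j<n. h \<in> W k j"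
      using h by (auto simp: W'_def)
    ultimately have "escape F n (max \<alpha>\<^sub>0 \<beta>, h)"
      using h W unfolding escape_def near_def by auto
    then show "\<exists>r. escape F n r" ..
  qed
  then obtain F where F: "\<And>n. escape F n (F n)"
    by blast
  define \<sigma> where "\<sigma> n = fst (F n)" for n
  define h where "h n = snd (F n)" for n
  obtain \<gamma> where \<gamma>: "omega1_lub (range \<sigma>) \<gamma>"
    using omega1_lub_exists[of "range \<sigma>"] by auto
  then have \<sigma>\<gamma>: "\<sigma> n \<le> \<gamma>" for n
    by (auto simp: omega1_lub_def)
  have h: "h n \<in> homeos_on X (K \<gamma>)" "h n \<notin> U" for n
    using F[of n] homeos_on_mono[OF mono_stage[OF \<sigma>\<gamma>[of n]]] by (auto simp: escape_def h_def \<sigma>_def)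
  have "\<alpha>\<^sub>0 \<le> \<gamma>"
    using F[of 0] \<sigma>\<gamma>[of 0] by (auto simp: escape_def \<sigma>_def)
  then have fK: "f \<in> homeos_on X (K \<gamma>)"
    using \<alpha>\<^sub>0 homeos_on_mono[OF mono_stage] by blast
  have "limitin (homeo_on_topology X (K \<gamma>)) h f sequentially"
  proof (rule limitin_homeo_on_topology[OF Hausdorff compact_stage fK h(1)])
    let ?\<Psi> = "\<Union>n. \<Phi> (\<sigma> n)"
    show "continuous_map X euclideanreal \<psi>" if "\<psi> \<in> ?\<Psi>" for \<psi>
      using that continuous_real by blast
    show "\<exists>\<psi>\<in>?\<Psi>. \<psi> x \<noteq> \<psi> y" if "x \<in> K \<gamma>" "y \<in> K \<gamma>" "x \<noteq> y" for x y
      using separating[OF \<gamma> that] by blast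
    fix \<psi> and \<epsilon> :: real
    assume "\<psi> \<in> ?\<Psi>" "\<epsilon> > 0"
    then obtain k where "\<psi> \<in> \<Phi> (\<sigma> k)"
      by blast
    then obtain j where \<psi>: "\<psi> = stage_function (\<sigma> k) j"
      using stage_function_surj by metis
    obtain N where N: "1 / real (Suc N) < \<epsilon>"
      using nat_approx_posE[OF \<open>\<epsilon> > 0\<close>] by blast
    have "\<bar>\<psi> (h n x) - \<psi> (f x)\<bar> < \<epsilon>" if "n \<ge> Max {Suc k, Suc j, N}" "x \<in> K \<gamma>" for n x
    proof -
      have "k < n" "j < n" "N \<le> n"
        using that(1) by auto
      moreover have "x \<in> topspace X"
        using that(2) compactin_subset_topspace[OF compact_stage] by blast
      ultimately have "\<bar>\<psi> (h n x) - \<psi> (f x)\<bar> < 1 / real (Suc n)"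
        using F[of n] unfolding escape_def \<psi> \<sigma>_def h_def by blast
      also have "\<dots> \<le> 1 / real (Suc N)"
        using \<open>N \<le> n\<close> by (simp add: frac_le)
      finally show ?thesis
        using N by simp
    qed
    then show "\<forall>\<^sub>F n in sequentially. \<forall>x\<in>K \<gamma>. \<bar>\<psi> (h n x) - \<psi> (f x)\<bar> < \<epsilon>"
      unfolding eventually_sequentially by blast
  qed
  moreover have "openin (homeo_on_topology X (K \<gamma>)) (U \<inter> homeos_on X (K \<gamma>))"
    using U compact_stage by (simp add: openin_homeos_cpt_colimit_topology)
  ultimately have "\<forall>\<^sub>F n in sequentially. h n \<in> U \<inter> homeos_on X (K \<gamma>)"
    using f fK unfolding limitin_def by blast
  then show False
    using h(2) by (simp add: eventually_sequentially)
qed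

theorem exhaustion_imp_CSHP: "CSHP X"
  unfolding CSHP_def topology_eq
proof (intro allI iffI)
  fix U assume "openin (homeos_cpt_colimit_topology X) U"
  then show "openin (homeos_cpt_stone_cech_topology X) U"
    using stone_cech_neighbourhood by (subst openin_subopen) blast
qed (rule stone_cech_topology_coarser)

end


section \<open>Embeddings and finite products\<close>

lemma omega1_exhaustible_embedding:
  assumes Y: "omega1_exhaustible Y" and g: "continuous_map X Y g" "inj_on g (topspace X)"
    and proper: "\<And>B. compactin Y B \<Longrightarrow> compactin X {x \<in> topspace X. g x \<in> B}"
  shows "omega1_exhaustible X"
proof -
  obtain K \<Phi> where "omega1_exhaustion Y K \<Phi>"
    using Y by (auto simp: omega1_exhaustible_def)
  then interpret omega1_exhaustion Y K \<Phi> .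
  have "omega1_exhaustion X (\<lambda>\<alpha>. {x \<in> topspace X. g x \<in> K \<alpha>}) (\<lambda>\<alpha>. (\<lambda>\<phi>. \<phi> \<circ> g) ` \<Phi> \<alpha>)"
  proof
    show "compactin X {x \<in> topspace X. g x \<in> K \<alpha>}" for \<alpha>
      by (rule proper[OF compact_stage])
    show "{x \<in> topspace X. g x \<in> K \<alpha>} \<subseteq> {x \<in> topspace X. g x \<in> K \<beta>}" if "\<alpha> \<le> \<beta>" for \<alpha> \<beta>
      using mono_stage[OF that] by blast
    show "\<exists>\<alpha>. A \<subseteq> {x \<in> topspace X. g x \<in> K \<alpha>}" if A: "compactin X A" for A
    proof -
      obtain \<alpha> where "g ` A \<subseteq> K \<alpha>"
        using cofinal[OF image_compactin[OF A g(1)]] by blast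
      then show ?thesis
        using compactin_subset_topspace[OF A] by blast
    qed
    show "countable ((\<lambda>\<phi>. \<phi> \<circ> g) ` \<Phi> \<alpha>)" for \<alpha>
      by (intro countable_image countable_functions)
    show "continuous_map X unit_interval \<phi>" if "\<phi> \<in> (\<lambda>\<phi>. \<phi> \<circ> g) ` \<Phi> \<alpha>" for \<phi> \<alpha>
      using that continuous_map_compose[OF g(1) continuous_function] by blast
    fix S \<gamma> x y
    assume *: "omega1_lub S \<gamma>" "x \<in> {x \<in> topspace X. g x \<in> K \<gamma>}" "y \<in> {x \<in> topspace X. g x \<in> K \<gamma>}" "x \<noteq> y"
    then have "g x \<noteq> g y"
      using g(2) by (auto dest: inj_onD)
    then show "\<exists>\<sigma>\<in>S. \<exists>\<phi>\<in>(\<lambda>\<phi>. \<phi> \<circ> g) ` \<Phi> \<sigma>. \<phi> x \<noteq> \<phi> y"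
      using separating[OF *(1), of "g x" "g y"] * by auto
  qed
  then show ?thesis
    by (auto simp: omega1_exhaustible_def)
qed

text \<open>
  Both factors are indexed by the same \<open>\<omega>\<^sub>1\<close>, so that a supremum for the product is a supremum for each
  factor; two points of the product differ in one of them.
\<close>

lemma omega1_exhaustible_prod_topology:
  assumes X: "omega1_exhaustible X" and Y: "omega1_exhaustible Y"
  shows "omega1_exhaustible (prod_topology X Y)"
proof -
  obtain K \<Phi> where "omega1_exhaustion X K \<Phi>"
    using X by (auto simp: omega1_exhaustible_def)
  then interpret X: omega1_exhaustion X K \<Phi> .
  obtain L \<Psi> where "omega1_exhaustion Y L \<Psi>"
    using Y by (auto simp: omega1_exhaustible_def)
  then interpret Y: omega1_exhaustion Y L \<Psi> .
  have "omega1_exhaustion (prod_topology X Y) (\<lambda>\<alpha>. K \<alpha> \<times> L \<alpha>)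
      (\<lambda>\<alpha>. (\<lambda>\<phi>. \<phi> \<circ> fst) ` \<Phi> \<alpha> \<union> (\<lambda>\<psi>. \<psi> \<circ> snd) ` \<Psi> \<alpha>)"
  proof
    show "compactin (prod_topology X Y) (K \<alpha> \<times> L \<alpha>)" for \<alpha>
      by (simp add: compactin_Times X.compact_stage Y.compact_stage)
    show "K \<alpha> \<times> L \<alpha> \<subseteq> K \<beta> \<times> L \<beta>" if "\<alpha> \<le> \<beta>" for \<alpha> \<beta>
      using X.mono_stage[OF that] Y.mono_stage[OF that] by blast
    show "\<exists>\<alpha>. A \<subseteq> K \<alpha> \<times> L \<alpha>" if A: "compactin (prod_topology X Y) A" for A
    proof -
      obtain \<alpha> \<beta> where "fst ` A \<subseteq> K \<alpha>" "snd ` A \<subseteq> L \<beta>"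
        using X.cofinal[OF image_compactin[OF A continuous_map_fst]]
          Y.cofinal[OF image_compactin[OF A continuous_map_snd]] by blast
      moreover have "K \<alpha> \<subseteq> K (max \<alpha> \<beta>)" "L \<beta> \<subseteq> L (max \<alpha> \<beta>)"
        by (simp_all add: X.mono_stage Y.mono_stage)
      ultimately have "A \<subseteq> K (max \<alpha> \<beta>) \<times> L (max \<alpha> \<beta>)"
        by force
      then show ?thesis ..
    qed
    show "countable ((\<lambda>\<phi>. \<phi> \<circ> fst) ` \<Phi> \<alpha> \<union> (\<lambda>\<psi>. \<psi> \<circ> snd) ` \<Psi> \<alpha>)" for \<alpha>
      by (intro countable_Un countable_image X.countable_functions Y.countable_functions)
    show "continuous_map (prod_topology X Y) unit_interval \<phi>"
      if "\<phi> \<in> (\<lambda>\<phi>. \<phi> \<circ> fst) ` \<Phi> \<alpha> \<union> (\<lambda>\<psi>. \<psi> \<circ> snd) ` \<Psi> \<alpha>" for \<phi> \<alpha>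
      using that continuous_map_compose[OF continuous_map_fst X.continuous_function]
        continuous_map_compose[OF continuous_map_snd Y.continuous_function] by blast
    fix S \<gamma> p q
    assume "omega1_lub S \<gamma>" "p \<in> K \<gamma> \<times> L \<gamma>" "q \<in> K \<gamma> \<times> L \<gamma>" "p \<noteq> q"
    then show "\<exists>\<sigma>\<in>S. \<exists>\<phi>\<in>(\<lambda>\<phi>. \<phi> \<circ> fst) ` \<Phi> \<sigma> \<union> (\<lambda>\<psi>. \<psi> \<circ> snd) ` \<Psi> \<sigma>. \<phi> p \<noteq> \<phi> q"
      using X.separating[of S \<gamma> "fst p" "fst q"] Y.separating[of S \<gamma> "snd p" "snd q"]
      unfolding bex_Un bex_simps o_apply
      by (metis mem_Times_iff prod_eqI)
  qed
  then show ?thesis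
    by (auto simp: omega1_exhaustible_def)
qed

lemma omega1_exhaustible_product_topology:
  assumes "finite I" and X: "\<And>i. i \<in> I \<Longrightarrow> omega1_exhaustible (X i)"
  shows "omega1_exhaustible (product_topology X I)"
proof -
  obtain K \<Phi> where K\<Phi>: "\<And>i. i \<in> I \<Longrightarrow> omega1_exhaustion (X i) (K i) (\<Phi> i)"
    using X unfolding omega1_exhaustible_def by metis
  have proj: "continuous_map (product_topology X I) (X i) (\<lambda>x. x i)" if "i \<in> I" for i
    by (rule continuous_map_product_projection[OF that])
  have "omega1_exhaustion (product_topology X I) (\<lambda>\<alpha>. PiE I (\<lambda>i. K i \<alpha>))
      (\<lambda>\<alpha>. \<Union>i\<in>I. (\<lambda>\<phi>. \<phi> \<circ> (\<lambda>x. x i)) ` \<Phi> i \<alpha>)"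
  proof
    show "compactin (product_topology X I) (PiE I (\<lambda>i. K i \<alpha>))" for \<alpha>
      by (simp add: compactin_PiE omega1_exhaustion.compact_stage[OF K\<Phi>])
    show "PiE I (\<lambda>i. K i \<alpha>) \<subseteq> PiE I (\<lambda>i. K i \<beta>)" if "\<alpha> \<le> \<beta>" for \<alpha> \<beta>
      using that by (intro PiE_mono omega1_exhaustion.mono_stage[OF K\<Phi>])
    show "\<exists>\<alpha>. A \<subseteq> PiE I (\<lambda>i. K i \<alpha>)" if A: "compactin (product_topology X I) A" for A
    proof -
      have "\<exists>\<alpha>. (\<lambda>x. x i) ` A \<subseteq> K i \<alpha>" if "i \<in> I" for i
        by (rule omega1_exhaustion.cofinal[OF K\<Phi>[OF that] image_compactin[OF A proj[OF that]]])
      then obtain \<alpha> where \<alpha>: "\<And>i. i \<in> I \<Longrightarrow> (\<lambda>x. x i) ` A \<subseteq> K i (\<alpha> i)"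
        by metis
      \<comment> \<open>\<open>undefined\<close> only serves to have a maximum when \<open>I\<close> is empty.\<close>
      define \<beta> where "\<beta> = Max (insert undefined (\<alpha> ` I))"
      have "K i (\<alpha> i) \<subseteq> K i \<beta>" if "i \<in> I" for i
        using \<open>finite I\<close> that by (intro omega1_exhaustion.mono_stage[OF K\<Phi>[OF that]]) (simp add: \<beta>_def)
      then have "x i \<in> K i \<beta>" if "x \<in> A" "i \<in> I" for x i
        using \<alpha>[OF that(2)] that by blast
      moreover have "A \<subseteq> extensional I"
        using compactin_subset_topspace[OF A] by (auto simp: PiE_def)
      ultimately have "A \<subseteq> PiE I (\<lambda>i. K i \<beta>)"
        by (auto simp: PiE_def)
      then show ?thesis ..
    qed
    show "countable (\<Union>i\<in>I. (\<lambda>\<phi>. \<phi> \<circ> (\<lambda>x. x i)) ` \<Phi> i \<alpha>)" for \<alpha>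
      using omega1_exhaustion.countable_functions[OF K\<Phi>] \<open>finite I\<close> by (simp add: countable_finite)
    show "continuous_map (product_topology X I) unit_interval \<phi>"
      if "\<phi> \<in> (\<Union>i\<in>I. (\<lambda>\<phi>. \<phi> \<circ> (\<lambda>x. x i)) ` \<Phi> i \<alpha>)" for \<phi> \<alpha>
      using that continuous_map_compose[OF proj omega1_exhaustion.continuous_function[OF K\<Phi>]] by blast
    fix S \<gamma> x y
    assume *: "omega1_lub S \<gamma>" "x \<in> PiE I (\<lambda>i. K i \<gamma>)" "y \<in> PiE I (\<lambda>i. K i \<gamma>)" "x \<noteq> y"
    then obtain i where i: "i \<in> I" "x i \<noteq> y i"
      by (metis PiE_ext)
    then obtain \<sigma> \<phi> where \<sigma>: "\<sigma> \<in> S" and \<phi>: "\<phi> \<in> \<Phi> i \<sigma>" "\<phi> (x i) \<noteq> \<phi> (y i)"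
      using omega1_exhaustion.separating[OF K\<Phi>[OF i(1)] *(1), of "x i" "y i"] * by auto
    show "\<exists>\<sigma>\<in>S. \<exists>\<phi>\<in>(\<Union>i\<in>I. (\<lambda>\<phi>. \<phi> \<circ> (\<lambda>x. x i)) ` \<Phi> i \<sigma>). \<phi> x \<noteq> \<phi> y"
      by (rule bexI[OF _ \<sigma>], rule bexI[of _ "\<phi> \<circ> (\<lambda>x. x i)"]) (use i \<phi> in auto)
  qed
  then show ?thesis
    by (auto simp: omega1_exhaustible_def)
qed


section \<open>Compact metrizable spaces\<close>

text \<open>
  Truncated distances to the points of a countable dense set; the latter comes from total boundedness.
\<close>

lemma compact_metrizable_countable_separating:
  assumes "compact_space X" "metrizable_space X"
  obtains \<Phi> where "countable \<Phi>" "\<And>\<phi>. \<phi> \<in> \<Phi> \<Longrightarrow> continuous_map X unit_interval \<phi>"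
    "\<And>x y. x \<in> topspace X \<Longrightarrow> y \<in> topspace X \<Longrightarrow> x \<noteq> y \<Longrightarrow> \<exists>\<phi>\<in>\<Phi>. \<phi> x \<noteq> \<phi> y"
proof -
  obtain M d where "Metric_space M d" and X: "X = Metric_space.mtopology M d"
    using assms(2) by (auto simp: metrizable_space_def)
  then interpret Metric_space M d by simp
  have "mtotally_bounded M"
    using assms(1) by (intro compactin_imp_mtotally_bounded) (simp add: X compact_space_def)
  then have "\<forall>n. \<exists>D. finite D \<and> D \<subseteq> M \<and> M \<subseteq> (\<Union>x\<in>D. mball x (1 / real (Suc n)))"
    unfolding mtotally_bounded_def by (metis of_nat_0_less_iff zero_less_Suc zero_less_divide_1_iff)
  then obtain D where D: "\<And>n. finite (D n)" "\<And>n. D n \<subseteq> M"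
    "\<And>n. M \<subseteq> (\<Union>x\<in>D n. mball x (1 / real (Suc n)))"
    by metis
  show thesis
  proof (rule that)
    let ?\<Phi> = "(\<lambda>c x. min 1 (d c x)) ` (\<Union>n. D n)"
    show "countable ?\<Phi>"
      using D(1) by (intro countable_image countable_UN) (auto intro: countable_finite)
    show "continuous_map X unit_interval \<phi>" if \<phi>_in: "\<phi> \<in> ?\<Phi>" for \<phi>
    proof -
      obtain c where c: "c \<in> M" and \<phi>: "\<phi> = (\<lambda>x. min 1 (d c x))"
        using \<phi>_in D(2) by auto
      have "continuous_map X euclideanreal (\<lambda>x. d c x)"
        using continuous_map_mdist[of X "metric (M, d)" "\<lambda>x. c" "\<lambda>x. x"] c
        by (simp add: X mtopology_of)
      then have "continuous_map X euclideanreal \<phi>"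
        unfolding \<phi> by (intro continuous_map_real_min) simp_all
      then show ?thesis
        by (simp add: continuous_map_in_subtopology \<phi>)
    qed
    fix x y assume xy: "x \<in> topspace X" "y \<in> topspace X" "x \<noteq> y"
    define \<delta> where "\<delta> = min 1 (d x y) / 2"
    have \<delta>: "0 < \<delta>" "2 * \<delta> \<le> 1" "2 * \<delta> \<le> d x y"
      using xy by (simp_all add: X \<delta>_def)
    obtain n where n: "1 / real (Suc n) < \<delta>"
      using nat_approx_posE[OF \<delta>(1)] by blast
    obtain c where c: "c \<in> D n" "x \<in> mball c (1 / real (Suc n))"
      using D(3)[of n] xy by (auto simp: X)
    then have cx: "c \<in> M" "d c x < \<delta>"
      using n by auto
    then have "d x y \<le> d c x + d c y"
      using triangle'[of x c y] xy by (auto simp: X commute)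
    then have "\<delta> < d c y"
      using cx \<delta> by linarith
    then have "min 1 (d c x) \<noteq> min 1 (d c y)"
      using cx(2) \<delta> by linarith
    moreover have "(\<lambda>x. min 1 (d c x)) \<in> ?\<Phi>"
      using c(1) by (intro imageI) auto
    ultimately show "\<exists>\<phi>\<in>?\<Phi>. \<phi> x \<noteq> \<phi> y"
      by (rule rev_bexI[rotated])
  qed
qed

lemma omega1_exhaustible_compact_metrizable:
  assumes "compact_space X" "metrizable_space X"
  shows "omega1_exhaustible X"
proof -
  obtain \<Phi> where \<Phi>: "countable \<Phi>" "\<And>\<phi>. \<phi> \<in> \<Phi> \<Longrightarrow> continuous_map X unit_interval \<phi>"
    "\<And>x y. x \<in> topspace X \<Longrightarrow> y \<in> topspace X \<Longrightarrow> x \<noteq> y \<Longrightarrow> \<exists>\<phi>\<in>\<Phi>. \<phi> x \<noteq> \<phi> y"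
    using compact_metrizable_countable_separating[OF assms] by blast
  have "omega1_exhaustion X (\<lambda>_. topspace X) (\<lambda>_. \<Phi>)"
    by unfold_locales
      (use assms(1) \<Phi> in \<open>auto simp: compact_space_def omega1_lub_def dest: compactin_subset_topspace\<close>)
  then show ?thesis
    by (auto simp: omega1_exhaustible_def)
qed


section \<open>Long linear orders\<close>

text \<open>
  The classical creeping argument: take the supremum of the points up to which the order is covered
  finitely. As the order may have jumps, the step beyond this supremum adds one more open set for the
  endpoint. The hypothesis applied to the whole type provides a least element.
\<close>

lemma compact_atMost_if_complete:
  fixes a :: "'a::linorder_topology"
  assumes inf: "\<And>S::'a set. S \<noteq> {} \<Longrightarrow> \<exists>i. (\<forall>s\<in>S. i \<le> s) \<and> (\<forall>j. (\<forall>s\<in>S. j \<le> s) \<longrightarrow> j \<le> i)"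
  shows "compact {..a}"
proof (rule compactI)
  fix \<C> :: "'a set set"
  assume op: "\<forall>U\<in>\<C>. open U" and cover: "{..a} \<subseteq> \<Union>\<C>"
  define fin where "fin A \<longleftrightarrow> (\<exists>\<D>\<subseteq>\<C>. finite \<D> \<and> A \<subseteq> \<Union>\<D>)" for A
  have fin_Un: "fin (A \<union> B)" if "fin A" "B \<subseteq> U" "U \<in> \<C>" for A B U
  proof -
    from that(1) obtain \<D> where "\<D> \<subseteq> \<C>" "finite \<D>" "A \<subseteq> \<Union>\<D>"
      by (auto simp: fin_def)
    then show ?thesis
      unfolding fin_def using that by (intro exI[of _ "insert U \<D>"]) auto
  qed
  have fin_mono: "fin A" if "fin B" "A \<subseteq> B" for A B
    using that unfolding fin_def by (meson order_trans)
  obtain b where b: "\<And>x::'a. b \<le> x"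
    using inf[of UNIV] by auto
  define S where "S = {x. x \<le> a \<and> fin {..x}}"
  have "b \<in> S"
  proof -
    obtain U where "U \<in> \<C>" "b \<in> U"
      using cover b by blast
    moreover have "{..b} = {b}"
      using b by (auto intro: antisym)
    ultimately have "fin {..b}"
      using fin_Un[of "{}" "{..b}" U] by (auto simp: fin_def)
    then show ?thesis
      by (simp add: S_def b)
  qed
  obtain s where ub: "\<And>x. x \<in> S \<Longrightarrow> x \<le> s" and least: "\<And>u. (\<And>x. x \<in> S \<Longrightarrow> x \<le> u) \<Longrightarrow> s \<le> u"
  proof -
    have "a \<in> {u. \<forall>x\<in>S. x \<le> u}"
      by (simp add: S_def)
    then show thesis
      using inf[of "{u. \<forall>x\<in>S. x \<le> u}"] that by blast
  qed
  have sa: "s \<le> a"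
    by (rule least) (simp add: S_def)
  obtain U where U: "U \<in> \<C>" "s \<in> U"
    using cover sa by blast
  have "s \<in> S"
  proof (cases "b < s")
    case True
    obtain u where u: "u < s" "{u<..s} \<subseteq> U"
      using open_left[OF _ U(2) True] op U(1) by blast
    then obtain x where "x \<in> S" "u < x"
      using least[of u] by (meson not_le)
    then have "fin ({..x} \<union> {u<..s})"
      using fin_Un u U by (auto simp: S_def)
    then have "fin {..s}"
      by (rule fin_mono) (use \<open>u < x\<close> in auto)
    then show ?thesis
      by (simp add: S_def sa)
  next
    case False
    then show ?thesis
      using b[of s] \<open>b \<in> S\<close> by (simp add: not_less antisym)
  qed
  have "s = a"
  proof (rule ccontr)
    assume "s \<noteq> a"
    then have "s < a"
      using sa by simp
    then obtain c where c: "s < c" "{s..<c} \<subseteq> U"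
      using open_right[OF _ U(2)] op U(1) by blast
    define m where "m = min c a"
    have m: "s < m" "m \<le> a" "m \<le> c"
      using c \<open>s < a\<close> by (auto simp: m_def)
    obtain V where V: "V \<in> \<C>" "m \<in> V"
      using cover m(2) by blast
    have "fin ({..s} \<union> {s..<c})"
      by (rule fin_Un[where U = U]) (use \<open>s \<in> S\<close> c U in \<open>auto simp: S_def\<close>)
    then have "fin (({..s} \<union> {s..<c}) \<union> {m})"
      by (rule fin_Un[where U = V]) (use V in auto)
    then have "fin {..m}"
      by (rule fin_mono) (use m in auto)
    then have "m \<in> S"
      using m by (simp add: S_def)
    then show False
      using ub m(1) by force
  qed
  then show "\<exists>\<D>\<subseteq>\<C>. finite \<D> \<and> {..a} \<subseteq> \<Union>\<D>"
    using \<open>s \<in> S\<close> by (simp add: S_def fin_def)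
qed

lemma Hausdorff_space_euclidean_t2: "Hausdorff_space (euclidean :: 'a::t2_space topology)"
  unfolding Hausdorff_space_def disjnt_def by (metis hausdorff open_openin)

text \<open>
  A Urysohn function for the cut between \<open>b\<close> and \<open>c\<close> in the compact segment \<open>{..a}\<close>, extended to be
  constant beyond \<open>a\<close>. The extension is continuous because it factors through the retraction
  \<open>x \<mapsto> min x a\<close>.
\<close>

definition cut_function :: "'a::linorder_topology \<Rightarrow> 'a \<Rightarrow> 'a \<Rightarrow> ('a \<Rightarrow> real) \<Rightarrow> bool"
  where "cut_function a b c \<phi> \<longleftrightarrow> continuous_map euclidean unit_interval \<phi> \<and>
    (\<forall>x\<le>a. x \<le> b \<longrightarrow> \<phi> x = 0) \<and> (\<forall>x\<le>a. c \<le> x \<longrightarrow> \<phi> x = 1) \<and> (\<forall>x. \<phi> x = \<phi> (min x a))"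

lemma cut_function_exists:
  fixes a b c :: "'a::linorder_topology"
  assumes "compact {..a}" "b < c"
  shows "\<exists>\<phi>. cut_function a b c \<phi>"
proof -
  let ?T = "top_of_set {..a}"
  have "compact_space ?T" "Hausdorff_space ?T"
    using assms(1) by (auto simp: compact_space_subtopology
        intro!: Hausdorff_space_subtopology Hausdorff_space_euclidean_t2)
  then have "normal_space ?T"
    using compact_Hausdorff_or_regular_imp_normal_space by blast
  moreover have "closedin ?T ({..a} \<inter> {..b})"
    by (rule closedin_closed_Int[OF closed_atMost])
  moreover have "closedin ?T ({..a} \<inter> {c..})"
    by (rule closedin_closed_Int[OF closed_atLeast])
  moreover have "disjnt ({..a} \<inter> {..b}) ({..a} \<inter> {c..})"
    using assms(2) by (auto simp: disjnt_def)
  ultimately obtain f where f: "continuous_map ?T unit_interval f"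
    "f ` ({..a} \<inter> {..b}) \<subseteq> {0}" "f ` ({..a} \<inter> {c..}) \<subseteq> {1::real}"
    by (rule Urysohn_lemma[OF _ _ _ _ zero_le_one])
  have "f x = 0" if "x \<le> a" "x \<le> b" for x
    using subsetD[OF f(2) imageI[of x]] that by simp
  moreover have "f x = 1" if "x \<le> a" "c \<le> x" for x
    using subsetD[OF f(3) imageI[of x]] that by simp
  moreover have "continuous_map euclidean ?T (\<lambda>x. min x a)"
    by (auto simp: continuous_map_in_subtopology intro!: continuous_intros)
  then have "continuous_map euclidean unit_interval (\<lambda>x. f (min x a))"
    using continuous_map_compose[OF _ f(1)] by (simp add: o_def)
  ultimately have "cut_function a b c (\<lambda>x. f (min x a))"
    by (simp add: cut_function_def min_absorb1)
  then show ?thesis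
    by blast
qed

text \<open>
  The stages are the segments up to \<open>c \<alpha>\<close>, and the functions of stage \<open>\<alpha>\<close> are cut functions for pairs
  from the countable dense set \<open>D \<alpha>\<close>. If \<open>x < y \<le> c \<gamma>\<close> and \<open>\<gamma>\<close> is the supremum of \<open>S\<close>, then some
  \<open>\<sigma> \<in> S\<close> has \<open>x < c \<sigma>\<close>, and the retraction onto \<open>{..c \<sigma>}\<close> still distinguishes \<open>x\<close> from \<open>y\<close>.
\<close>

lemma omega1_exhaustible_linorder:
  fixes c :: "omega1 \<Rightarrow> 'a::linorder_topology" and D :: "omega1 \<Rightarrow> 'a set"
  assumes inf: "\<And>S::'a set. S \<noteq> {} \<Longrightarrow> \<exists>i. (\<forall>s\<in>S. i \<le> s) \<and> (\<forall>j. (\<forall>s\<in>S. j \<le> s) \<longrightarrow> j \<le> i)"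
    and mono: "mono c" and unbounded: "\<And>x. \<exists>\<alpha>. x \<le> c \<alpha>"
    and lub: "\<And>S \<gamma> x. omega1_lub S \<gamma> \<Longrightarrow> x < c \<gamma> \<Longrightarrow> \<exists>\<sigma>\<in>S. x < c \<sigma>"
    and D: "\<And>\<alpha>. countable (D \<alpha>)"
    and dense: "\<And>\<alpha> x y. x < y \<Longrightarrow> y \<le> c \<alpha> \<Longrightarrow> \<exists>b\<in>D \<alpha>. \<exists>d\<in>D \<alpha>. x \<le> b \<and> b < d \<and> d \<le> y"
  shows "omega1_exhaustible (euclidean :: 'a topology)"
proof -
  have cpt: "compact {..c \<alpha>}" for \<alpha>
    by (rule compact_atMost_if_complete) (rule inf)
  define \<phi> where "\<phi> \<alpha> b d = (SOME \<phi>. cut_function (c \<alpha>) b d \<phi>)" for \<alpha> b d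
  have \<phi>: "cut_function (c \<alpha>) b d (\<phi> \<alpha> b d)" if "b < d" for \<alpha> b d
    unfolding \<phi>_def by (rule someI_ex[OF cut_function_exists[OF cpt that]])
  define \<Phi> where "\<Phi> \<alpha> = (\<lambda>(b, d). \<phi> \<alpha> b d) ` {(b, d) \<in> D \<alpha> \<times> D \<alpha>. b < d}" for \<alpha>
  have "omega1_exhaustion euclidean (\<lambda>\<alpha>. {..c \<alpha>}) \<Phi>"
  proof
    show "compactin euclidean {..c \<alpha>}" for \<alpha>
      using cpt by simp
    show "{..c \<alpha>} \<subseteq> {..c \<beta>}" if "\<alpha> \<le> \<beta>" for \<alpha> \<beta>
      using monoD[OF mono that] by auto
    show "\<exists>\<alpha>. A \<subseteq> {..c \<alpha>}" if A: "compactin euclidean A" for A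
    proof (cases "A = {}")
      case False
      then obtain s where "\<forall>t\<in>A. t \<le> s"
        using compact_attains_sup[of A] A by auto
      moreover obtain \<alpha> where "s \<le> c \<alpha>"
        using unbounded by blast
      ultimately have "A \<subseteq> {..c \<alpha>}"
        by force
      then show ?thesis ..
    qed simp
    show "countable (\<Phi> \<alpha>)" for \<alpha>
      unfolding \<Phi>_def by (rule countable_image, rule countable_subset[of _ "D \<alpha> \<times> D \<alpha>"]) (auto simp: D)
    show "continuous_map euclidean unit_interval \<psi>" if "\<psi> \<in> \<Phi> \<alpha>" for \<psi> \<alpha>
      using that \<phi> by (auto simp: \<Phi>_def cut_function_def)
    have sep: "\<exists>\<sigma>\<in>S. \<exists>\<psi>\<in>\<Phi> \<sigma>. \<psi> x \<noteq> \<psi> y" if S: "omega1_lub S \<gamma>" and xy: "x < y" "y \<le> c \<gamma>" for S \<gamma> x y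
    proof -
      have "x < c \<gamma>"
        using xy by (rule less_le_trans)
      then obtain \<sigma> where \<sigma>: "\<sigma> \<in> S" "x < c \<sigma>"
        using lub[OF S] by blast
      then have "x < min y (c \<sigma>)"
        using xy by simp
      then obtain b d where bd: "b \<in> D \<sigma>" "d \<in> D \<sigma>" "x \<le> b" "b < d" "d \<le> min y (c \<sigma>)"
        using dense[of x "min y (c \<sigma>)" \<sigma>] by auto
      have cut: "cut_function (c \<sigma>) b d (\<phi> \<sigma> b d)"
        by (rule \<phi>) fact
      then have "\<And>z. z \<le> c \<sigma> \<Longrightarrow> z \<le> b \<Longrightarrow> \<phi> \<sigma> b d z = 0"
        "\<And>z. z \<le> c \<sigma> \<Longrightarrow> d \<le> z \<Longrightarrow> \<phi> \<sigma> b d z = 1"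
        "\<phi> \<sigma> b d y = \<phi> \<sigma> b d (min y (c \<sigma>))"
        unfolding cut_function_def by blast+
      then have "\<phi> \<sigma> b d x = 0" "\<phi> \<sigma> b d y = 1"
        using bd \<sigma> by simp_all
      moreover have "\<phi> \<sigma> b d \<in> \<Phi> \<sigma>"
        using bd by (auto simp: \<Phi>_def)
      ultimately show ?thesis
        using \<sigma>(1) by (intro bexI[of _ \<sigma>] bexI[of _ "\<phi> \<sigma> b d"]) simp_all
    qed
    fix S \<gamma> x y
    assume *: "omega1_lub S \<gamma>" "x \<in> {..c \<gamma>}" "y \<in> {..c \<gamma>}" "x \<noteq> y"
    then consider "x < y" | "y < x"
      by fastforce
    then show "\<exists>\<sigma>\<in>S. \<exists>\<psi>\<in>\<Phi> \<sigma>. \<psi> x \<noteq> \<psi> y"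
    proof cases
      case 1
      then show ?thesis
        using sep * by auto
    next
      case 2
      then have "\<exists>\<sigma>\<in>S. \<exists>\<psi>\<in>\<Phi> \<sigma>. \<psi> y \<noteq> \<psi> x"
        using sep * by auto
      then show ?thesis
        by metis
    qed
  qed
  then show ?thesis
    by (auto simp: omega1_exhaustible_def)
qed

lemma omega1_exhaustible_omega1: "omega1_exhaustible (euclidean :: omega1 topology)"
proof (rule omega1_exhaustible_linorder[of "\<lambda>\<alpha>. \<alpha>" "\<lambda>\<alpha>. {..\<alpha>}"])
  fix S :: "omega1 set"
  assume "S \<noteq> {}"
  then have "(LEAST s. s \<in> S) \<in> S"
    by (auto intro: LeastI)
  then show "\<exists>i. (\<forall>s\<in>S. i \<le> s) \<and> (\<forall>j. (\<forall>s\<in>S. j \<le> s) \<longrightarrow> j \<le> i)"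
    by (intro exI[of _ "LEAST s. s \<in> S"]) (auto intro: Least_le)
next
  show "countable {..\<alpha> :: omega1}" for \<alpha>
    by (rule countable_atMost_omega1)
  show "\<exists>b\<in>{..\<alpha>}. \<exists>d\<in>{..\<alpha>}. x \<le> b \<and> b < d \<and> d \<le> y" if "x < y" "y \<le> \<alpha>" for x y \<alpha> :: omega1
    using that by (intro bexI[of _ x] bexI[of _ y]) auto
  show "\<exists>\<sigma>\<in>S. x < \<sigma>" if "omega1_lub S \<gamma>" "x < \<gamma>" for S \<gamma> and x :: omega1
    using that by (simp add: omega1_lub_def)
  show "mono (\<lambda>\<alpha> :: omega1. \<alpha>)"
    by (simp add: mono_def)
  show "\<exists>\<alpha>. x \<le> \<alpha>" for x :: omega1
    by blast
qed

definition ray_point :: "omega1 \<Rightarrow> real \<Rightarrow> long_ray"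
  where "ray_point \<alpha> t = Abs_long_ray (\<alpha>, t)"

lemma ray_point_cases:
  obtains \<alpha> t where "0 \<le> t" "t < 1" "x = ray_point \<alpha> t"
proof -
  have "snd (Rep_long_ray x) \<in> {0..<1}"
    using Rep_long_ray[of x] by (simp add: mem_Times_iff)
  moreover have "x = ray_point (fst (Rep_long_ray x)) (snd (Rep_long_ray x))"
    by (simp add: ray_point_def Rep_long_ray_inverse)
  ultimately show thesis
    using that by auto
qed

lemma ray_point_le_iff:
  assumes "0 \<le> s" "s < 1" "0 \<le> t" "t < 1"
  shows "ray_point \<alpha> s \<le> ray_point \<beta> t \<longleftrightarrow> \<alpha> < \<beta> \<or> \<alpha> = \<beta> \<and> s \<le> t"
  using assms by (simp add: ray_point_def less_eq_long_ray_def Abs_long_ray_inverse)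

lemma ray_point_less_iff:
  assumes "0 \<le> s" "s < 1" "0 \<le> t" "t < 1"
  shows "ray_point \<alpha> s < ray_point \<beta> t \<longleftrightarrow> \<alpha> < \<beta> \<or> \<alpha> = \<beta> \<and> s < t"
  using assms by (auto simp: less_le_not_le ray_point_le_iff)

text \<open>
  Infima are easier than suprema here: the first coordinate is a minimum in a well-order, and the
  infimum of reals in \<open>[0,1)\<close> stays in \<open>[0,1)\<close>.
\<close>

lemma long_ray_greatest_lower_bound:
  fixes S :: "long_ray set"
  assumes "S \<noteq> {}"
  shows "\<exists>i. (\<forall>s\<in>S. i \<le> s) \<and> (\<forall>j. (\<forall>s\<in>S. j \<le> s) \<longrightarrow> j \<le> i)"
proof -
  define P where "P \<alpha> t \<longleftrightarrow> 0 \<le> t \<and> t < 1 \<and> ray_point \<alpha> t \<in> S" for \<alpha> t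
  have "\<exists>\<alpha> t. P \<alpha> t"
    using assms ray_point_cases unfolding P_def by (metis ex_in_conv)
  define \<beta> where "\<beta> = (LEAST \<alpha>. \<exists>t. P \<alpha> t)"
  have \<beta>: "\<exists>t. P \<beta> t"
    unfolding \<beta>_def by (rule LeastI_ex) fact
  define u where "u = Inf {t. P \<beta> t}"
  have bdd: "bdd_below {t. P \<beta> t}"
    by (rule bdd_belowI[of _ 0]) (simp add: P_def)
  have u0: "0 \<le> u"
    unfolding u_def using \<beta> by (intro cInf_greatest) (auto simp: P_def)
  obtain t\<^sub>0 where t\<^sub>0: "P \<beta> t\<^sub>0"
    using \<beta> by blast
  have u_le: "u \<le> t" if "P \<beta> t" for t
    unfolding u_def using that bdd by (intro cInf_lower) auto
  have u1: "u < 1"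
    using u_le[OF t\<^sub>0] t\<^sub>0 by (simp add: P_def)
  show ?thesis
  proof (intro exI[of _ "ray_point \<beta> u"] conjI ballI allI impI)
    fix x assume x: "x \<in> S"
    obtain \<alpha> t where t: "0 \<le> t" "t < 1" "x = ray_point \<alpha> t"
      by (rule ray_point_cases)
    then have P: "P \<alpha> t"
      using x by (simp add: P_def)
    then have "\<beta> \<le> \<alpha>"
      unfolding \<beta>_def by (blast intro: Least_le)
    then show "ray_point \<beta> u \<le> x"
      using t u0 u1 u_le P by (auto simp: ray_point_le_iff)
  next
    fix j assume j: "\<forall>x\<in>S. j \<le> x"
    obtain \<alpha> t where t: "0 \<le> t" "t < 1" "j = ray_point \<alpha> t"
      by (rule ray_point_cases)
    have *: "\<alpha> < \<beta> \<or> \<alpha> = \<beta> \<and> t \<le> r" if "P \<beta> r" for r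
      using j that t by (auto simp: P_def ray_point_le_iff)
    have "t \<le> u" if "\<alpha> = \<beta>"
      unfolding u_def using \<beta> * that by (intro cInf_greatest) auto
    then show "j \<le> ray_point \<beta> u"
      using t u0 u1 *[OF t\<^sub>0] by (auto simp: ray_point_le_iff)
  qed
qed

lemma omega1_exhaustible_long_ray: "omega1_exhaustible (euclidean :: long_ray topology)"
proof (rule omega1_exhaustible_linorder[of "\<lambda>\<alpha>. ray_point \<alpha> 0"
      "\<lambda>\<alpha>. (\<lambda>(\<beta>, q). ray_point \<beta> q) ` ({..\<alpha>} \<times> (\<rat> \<inter> {0..<1}))"])
  let ?D = "\<lambda>\<alpha>. (\<lambda>(\<beta>, q). ray_point \<beta> q) ` ({..\<alpha>} \<times> (\<rat> \<inter> {0..<1}))"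
  show "\<exists>i. (\<forall>s\<in>S. i \<le> s) \<and> (\<forall>j. (\<forall>s\<in>S. j \<le> s) \<longrightarrow> j \<le> i)" if "S \<noteq> {}" for S :: "long_ray set"
    by (rule long_ray_greatest_lower_bound[OF that])
  show "mono (\<lambda>\<alpha>. ray_point \<alpha> 0)"
    by (auto simp: mono_def ray_point_le_iff)
  show "\<exists>\<alpha>. x \<le> ray_point \<alpha> 0" for x
  proof -
    obtain \<alpha> t where t: "0 \<le> t" "t < 1" "x = ray_point \<alpha> t"
      by (rule ray_point_cases)
    have "{..\<alpha>} \<noteq> UNIV"
      using countable_atMost_omega1[of \<alpha>] uncountable_omega1 by metis
    then obtain \<beta> where "\<alpha> < \<beta>"
      by (metis UNIV_eq_I atMost_iff not_le)
    then show ?thesis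
      using t by (intro exI[of _ \<beta>]) (simp add: ray_point_le_iff)
  qed
  show "\<exists>\<sigma>\<in>S. x < ray_point \<sigma> 0" if "omega1_lub S \<gamma>" "x < ray_point \<gamma> 0" for S \<gamma> x
  proof -
    obtain \<alpha> t where "0 \<le> t" "t < 1" "x = ray_point \<alpha> t"
      by (rule ray_point_cases)
    then show ?thesis
      using that by (auto simp: omega1_lub_def ray_point_less_iff)
  qed
  show "countable (?D \<alpha>)" for \<alpha>
    by (intro countable_image countable_SIGMA countable_atMost_omega1 countable_Int1 countable_rat)
  fix \<alpha> x y
  assume xy: "x < y" "y \<le> ray_point \<alpha> 0"
  obtain \<beta> s where s: "0 \<le> s" "s < 1" "x = ray_point \<beta> s"
    by (rule ray_point_cases)
  obtain \<gamma> t where t: "0 \<le> t" "t < 1" "y = ray_point \<gamma> t"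
    by (rule ray_point_cases)
  have \<beta>\<gamma>: "\<beta> < \<gamma> \<or> \<beta> = \<gamma> \<and> s < t" and \<gamma>\<alpha>: "\<gamma> \<le> \<alpha>"
    using xy s t by (auto simp: ray_point_less_iff ray_point_le_iff)
  \<comment> \<open>Both points of the dense set can be taken in the copy of \<open>[0,1)\<close> that contains \<open>x\<close>; \<open>r\<close> is the
    position below which this copy is still below \<open>y\<close>.\<close>
  define r where "r = (if \<beta> < \<gamma> then 1 else t)"
  have r: "s < r" "r \<le> 1"
    using \<beta>\<gamma> s t by (auto simp: r_def)
  obtain p where p: "p \<in> \<rat>" "s < p" "p < r"
    using Rats_dense_in_real[OF r(1)] by blast
  obtain q where q: "q \<in> \<rat>" "p < q" "q < r"
    using Rats_dense_in_real[OF p(3)] by blast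
  show "\<exists>b\<in>?D \<alpha>. \<exists>d\<in>?D \<alpha>. x \<le> b \<and> b < d \<and> d \<le> y"
  proof (intro bexI conjI)
    show "x \<le> ray_point \<beta> p" "ray_point \<beta> p < ray_point \<beta> q"
      using s p q r by (simp_all add: ray_point_le_iff ray_point_less_iff)
    show "ray_point \<beta> q \<le> y"
      using s p q r t \<beta>\<gamma> by (auto simp: ray_point_le_iff r_def split: if_splits)
    have "\<beta> \<le> \<alpha>"
      using \<beta>\<gamma> \<gamma>\<alpha> by auto
    then show "ray_point \<beta> p \<in> ?D \<alpha>"
      by (intro image_eqI[of _ _ "(\<beta>, p)"]) (use s p q r in auto)
    show "ray_point \<beta> q \<in> ?D \<alpha>"
      by (rule image_eqI[of _ _ "(\<beta>, q)"]) (use s p q r \<open>\<beta> \<le> \<alpha>\<close> in auto)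
  qed
qed


section \<open>The Long Line\<close>

text \<open>
  Collapsing one half of the Long Line to \<open>0\<close>. The two collapses together embed the Long Line as a
  closed subspace, the union of the two axes, of a product of two Closed Long Rays.
\<close>

lift_definition long_line_part :: "bool \<Rightarrow> long_line \<Rightarrow> long_ray"
  is "\<lambda>b p. if fst p = b then snd p else 0"
  by auto

lemma continuous_long_line_part: "continuous_map euclidean euclidean (long_line_part b)"
proof -
  have "open ((\<lambda>p. if fst p = b then snd p else 0) -` U)" if "open U" for U :: "long_ray set"
  proof -
    have "(\<lambda>p. if fst p = b then snd p else 0) -` U =
        {b} \<times> U \<union> {\<not> b} \<times> (if 0 \<in> U then UNIV else {})"
      by (auto split: if_splits)
    then show ?thesis
      using that by (auto intro!: open_Un open_Times open_discrete)
  qed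
  then have "continuous_map euclidean euclidean (long_line_part b \<circ> abs_long_line)"
    by (simp add: continuous_map_def o_def long_line_part.abs_eq vimage_def)
  then show ?thesis
    by (simp add: continuous_compose_quotient_map_eq[OF quotient_map_abs_long_line])
qed

lemma omega1_exhaustible_long_line: "omega1_exhaustible (euclidean :: long_line topology)"
proof (rule omega1_exhaustible_embedding)
  let ?Y = "prod_topology (euclidean :: long_ray topology) (euclidean :: long_ray topology)"
  let ?g = "\<lambda>x. (long_line_part True x, long_line_part False x)"
  show "omega1_exhaustible ?Y"
    by (intro omega1_exhaustible_prod_topology omega1_exhaustible_long_ray)
  show cont: "continuous_map euclidean ?Y ?g"
    by (intro continuous_map_pairedI continuous_long_line_part)
  have abs: "surj abs_long_line"
    by (rule surjI[of _ rep_long_line]) (rule Quotient3_abs_rep[OF Quotient3_long_line])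
  show "inj_on ?g (topspace euclidean)"
  proof (rule inj_onI)
    fix x y assume eq: "?g x = ?g y"
    obtain p q where "x = abs_long_line p" "y = abs_long_line q"
      using abs by (metis surjD)
    with eq show "x = y"
      by (cases p; cases q) (auto simp: long_line_part.abs_eq long_line.abs_eq_iff split: if_splits)
  qed
  fix B assume B: "compactin ?Y B"
  define E where "E = fst ` B \<union> snd ` B"
  have "compact E"
    using image_compactin[OF B continuous_map_fst] image_compactin[OF B continuous_map_snd]
    by (auto simp: E_def)
  then have "compactin euclidean ((UNIV :: bool set) \<times> E)"
    by (simp add: compact_Times finite_imp_compact)
  then have "compactin euclidean (abs_long_line ` (UNIV \<times> E))"
    by (rule image_compactin) (rule quotient_imp_continuous_map[OF quotient_map_abs_long_line])
  then show "compactin euclidean {x \<in> topspace euclidean. ?g x \<in> B}"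
  proof (rule closed_compactin)
    show "closedin euclidean {x \<in> topspace euclidean. ?g x \<in> B}"
    proof (rule closedin_continuous_map_preimage[OF cont compactin_imp_closedin[OF _ B]])
      show "Hausdorff_space ?Y"
        by (simp add: Hausdorff_space_prod_topology Hausdorff_space_euclidean_t2)
    qed
    show "{x \<in> topspace euclidean. ?g x \<in> B} \<subseteq> abs_long_line ` (UNIV \<times> E)"
    proof (rule subsetI)
      fix x assume "x \<in> {x \<in> topspace euclidean. ?g x \<in> B}"
      then have "long_line_part True x \<in> E" "long_line_part False x \<in> E"
        by (force simp: E_def)+
      moreover obtain p where p: "x = abs_long_line p"
        using abs by (metis surjD)
      ultimately have "snd p \<in> E"
        by (cases "fst p") (auto simp: long_line_part.abs_eq)
      then show "x \<in> abs_long_line ` (UNIV \<times> E)"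
        by (simp add: p mem_Times_iff)
    qed
  qed
qed


section \<open>The product theorem\<close>

theorem theorem1:
  fixes C :: "'c topology" and n m l :: nat
  assumes "compact_space C" and "metrizable_space C"
  shows "CSHP
    (prod_topology (product_topology (\<lambda>_. euclidean :: long_line topology) {..<n})
    (prod_topology (product_topology (\<lambda>_. euclidean :: long_ray topology) {..<m})
    (prod_topology (product_topology (\<lambda>_. euclidean :: omega1 topology) {..<l})
      C)))" (is "CSHP ?X")
proof -
  have "omega1_exhaustible ?X"
    by (intro omega1_exhaustible_prod_topology omega1_exhaustible_product_topology
        omega1_exhaustible_long_line omega1_exhaustible_long_ray omega1_exhaustible_omega1
        omega1_exhaustible_compact_metrizable assms finite_lessThan)
  then show ?thesis
    using omega1_exhaustion.exhaustion_imp_CSHP by (auto simp: omega1_exhaustible_def)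
qed

end
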